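(* Let $(M^{m+d},H,g_H)$ be a compact connected sub-Riemannian manifold with $g_H=g|_H$ for a Riemannian metric $g$ on $M$, let $S^n\subset\mathbb{R}^{n+1}$ be the unit sphere with its induced metric, and let $f:M\to S^n$ be a nonconstant exponentially subelliptic harmonic map. If $$\int_M e^{\frac{|df_H|^2}{2}}\,|df_H|^2\big(|df_H|^2-(n-2)\big)\,dv_g<0,$$ then $f$ is unstable.
   Context: Manifolds are without boundary. Let $(M^{m+d},g)$ be a compact connected Riemannian manifold of dimension $m+d$, $H\subset TM$ a smooth subbundle of rank $m$, and $g_H=g|_H$; the triple $(M,H,g_H)$ is called a sub-Riemannian manifold (no further condition on $H$ is imposed). $TM=H\oplus H^\perp$ is the $g$-orthogonal decomposition, $\pi_H:TM\to H$ is the orthogonal projection, and $\{e_1,\dots,e_m\}$ is a local $g$-orthonormal frame of $H$. $dv_g$ is the Riemannian volume element. For a smooth map $f:M\to N$ into a Riemannian manifold $(N,h)$, $\langle\cdot,\cdot\rangle$ on $f^{-1}TN$ is induced by $h$, $\tilde\nabla$ (acting on sections of $f^{-1}TN$) is the pull-back of the Levi-Civita connection of $(N,h)$, $df_H=df\circ\pi_H$, and $|df_H|^2=\sum_{i=1}^m\langle df(e_i),df(e_i)\rangle$. $\tilde R$ is the curvature tensor of $N$, with the convention $\tilde R(X,Y)Z=\tilde\nabla_X\tilde\nabla_YZ-\tilde\nabla_Y\tilde\nabla_XZ-\tilde\nabla_{[X,Y]}Z$, so that $\langle\tilde R(X,Y)Y,X\rangle$ is the sectional curvature of the plane spanned by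 orthonormal $X,Y$. The horizontal exponential energy is $E(f)=\int_M e^{\frac{|df_H|^2}{2}}\,dv_g$. A smooth map $f$ is called exponentially subelliptic harmonic if it is a critical point of $E$, i.e. $\frac{d}{dt}E(f_t)|_{t=0}=0$ for every smooth one-parameter family $f_t$ with $f_0=f$ whose variation vector field has compact support. For an exponentially subelliptic harmonic map $f$ and $V\in\Gamma(f^{-1}TN)$ put $$I_H(V,V)=\int_M e^{\frac{|df_H|^2}{2}}\Big[\Big(\sum_{i=1}^m\langle\tilde\nabla_{e_i}V,df(e_i)\rangle\Big)^2+\sum_{i=1}^m\langle\tilde\nabla_{e_i}V,\tilde\nabla_{e_i}V\rangle-\sum_{i=1}^m\langle\tilde R(df(e_i),V)V,df(e_i)\rangle\Big]dv_g.$$ $f$ is called stable if $I_H(V,V)\ge0$ for every compactly supported smooth vector field $V$ along $f$, and unstable if it is not stable, i.e. if $I_H(V,V)<0$ for some such $V$. *)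

theory Defs
  imports "HOL-Analysis.Analysis"
begin

section \<open>Smooth maps between Euclidean spaces\<close>

text \<open>Meant for open \<open>S\<close>: all iterated directional derivatives up to order \<open>k\<close> exist and
  are continuous.\<close>

primrec Ck_on ::
  "nat \<Rightarrow> 'a::euclidean_space set \<Rightarrow> ('a \<Rightarrow> 'b::euclidean_space) \<Rightarrow> bool" where
  "Ck_on 0 S f \<longleftrightarrow> continuous_on S f"
| "Ck_on (Suc k) S f \<longleftrightarrow>
     f differentiable_on S \<and> (\<forall>v. Ck_on k S (\<lambda>x. frechet_derivative f (at x) v))"

definition smooth_on ::
  "'a::euclidean_space set \<Rightarrow> ('a \<Rightarrow> 'b::euclidean_space) \<Rightarrow> bool" where
  "smooth_on S f \<longleftrightarrow> (\<forall>k. Ck_on k S f)"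


section \<open>Sub-Riemannian manifolds\<close>

text \<open>The manifold \<open>M\<close> is a whole type \<open>'a\<close> (Hausdorff, second countable, by its sort); its
  dimension is \<open>CARD('k)\<close>. A chart is a pair of its domain and its coordinate map. The atlas
  need not be maximal.\<close>

type_synonym ('a, 'k) chart = "'a set \<times> ('a \<Rightarrow> real^'k)"

definition chart_inv :: "('a, 'k::finite) chart \<Rightarrow> real^'k \<Rightarrow> 'a" where
  "chart_inv c = inv_into (fst c) (snd c)"

definition smooth_atlas ::
  "('a::{t2_space, second_countable_topology}, 'k::finite) chart set \<Rightarrow> bool" where
  "smooth_atlas A \<longleftrightarrow>
     (\<Union>c\<in>A. fst c) = UNIV \<and>
     (\<forall>c\<in>A. open (fst c) \<and> open (snd c ` fst c) \<and>
        homeomorphism (fst c) (snd c ` fst c) (snd c) (chart_inv c)) \<and>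
     (\<forall>c\<in>A. \<forall>c'\<in>A. smooth_on (snd c ` (fst c \<inter> fst c')) (snd c' \<circ> chart_inv c))"

text \<open>A tangent vector at \<open>p\<close> is represented, in a chart \<open>c\<close> around \<open>p\<close>, by its coordinate
  vector in \<open>real^'k\<close>; the coordinate vectors \<open>v\<close> (with respect to \<open>c\<close>) and
  \<open>transition c c' p v\<close> (with respect to \<open>c'\<close>) represent the same tangent vector.
  Objects on \<open>TM\<close> (subbundles, metrics, connections) are accordingly families indexed by a
  chart and a point that are invariant under this change of chart.\<close>

definition transition ::
  "('a, 'k::finite) chart \<Rightarrow> ('a, 'k) chart \<Rightarrow> 'a \<Rightarrow> real^'k \<Rightarrow> real^'k" where
  "transition c c' p v = frechet_derivative (snd c' \<circ> chart_inv c) (at (snd c p)) v"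

definition smooth_map ::
  "('a, 'k::finite) chart set \<Rightarrow> ('a \<Rightarrow> 'b::euclidean_space) \<Rightarrow> bool" where
  "smooth_map A f \<longleftrightarrow> (\<forall>c\<in>A. smooth_on (snd c ` fst c) (f \<circ> chart_inv c))"

text \<open>The value \<open>df(v)\<close>, for the tangent vector with coordinate vector \<open>v\<close> in the chart
  \<open>c\<close> at \<open>p\<close>.\<close>

definition differential ::
  "('a \<Rightarrow> 'b::euclidean_space) \<Rightarrow> ('a, 'k::finite) chart \<Rightarrow> 'a \<Rightarrow> real^'k \<Rightarrow> 'b" where
  "differential f c p v = frechet_derivative (f \<circ> chart_inv c) (at (snd c p)) v"

definition riemannian_metric ::
  "('a, 'k::finite) chart set \<Rightarrow>
   (('a, 'k) chart \<Rightarrow> 'a \<Rightarrow> real^'k \<Rightarrow> real^'k \<Rightarrow> real) \<Rightarrow> bool" where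
  "riemannian_metric A g \<longleftrightarrow>
     (\<forall>c\<in>A. \<forall>p\<in>fst c.
        bilinear (g c p) \<and>
        (\<forall>u v. g c p u v = g c p v u) \<and>
        (\<forall>v. v \<noteq> 0 \<longrightarrow> g c p v v > 0) \<and>
        (\<forall>c'\<in>A. p \<in> fst c' \<longrightarrow>
           (\<forall>u v. g c' p (transition c c' p u) (transition c c' p v) = g c p u v))) \<and>
     (\<forall>c\<in>A. \<forall>u v. smooth_on (snd c ` fst c) (\<lambda>x. g c (chart_inv c x) u v))"

definition smooth_subbundle ::
  "('a::topological_space, 'k::finite) chart set \<Rightarrow> nat \<Rightarrow>
   (('a, 'k) chart \<Rightarrow> 'a \<Rightarrow> (real^'k) set) \<Rightarrow> bool" where
  "smooth_subbundle A m H \<longleftrightarrow>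
     (\<forall>c\<in>A. \<forall>p\<in>fst c.
        subspace (H c p) \<and> dim (H c p) = m \<and>
        (\<forall>c'\<in>A. p \<in> fst c' \<longrightarrow> H c' p = transition c c' p ` H c p) \<and>
        (\<exists>W E. open W \<and> p \<in> W \<and> W \<subseteq> fst c \<and>
           (\<forall>i<m. smooth_on (snd c ` W) (E i)) \<and>
           (\<forall>q\<in>W. span ((\<lambda>i. E i (snd c q)) ` {..<m}) = H c q)))"

text \<open>\<open>dv_g\<close> is the Borel measure given in every chart by
  \<open>sqrt (det (g_ij)) dx\<^sub>1 \<dots> dx\<^sub>k\<close>; this determines it uniquely.\<close>

definition riemannian_volume ::
  "('a::topological_space, 'k::finite) chart set \<Rightarrow>
   (('a, 'k) chart \<Rightarrow> 'a \<Rightarrow> real^'k \<Rightarrow> real^'k \<Rightarrow> real) \<Rightarrow> 'a measure \<Rightarrow> bool" where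
  "riemannian_volume A g vol \<longleftrightarrow>
     sets vol = sets borel \<and>
     (\<forall>c\<in>A. \<forall>B\<in>sets borel. B \<subseteq> fst c \<longrightarrow>
        emeasure vol B =
          (\<integral>\<^sup>+x. ennreal (sqrt (det (\<chi> i j. g c (chart_inv c x) (axis i 1) (axis j 1))))
                 * indicator (snd c ` B) x \<partial>lborel))"

text \<open>All quantities below depend on \<open>e\<^sub>1, \<dots>, e\<^sub>m\<close> only through expressions that are
  independent of the orthonormal frame of \<open>H\<close> and of the chart, and only through the values
  at the point in question; so at every point some chart and some orthonormal basis of the
  fibre \<open>H\<^sub>p\<close> are fixed.\<close>

definition chart_at :: "('a, 'k::finite) chart set \<Rightarrow> 'a \<Rightarrow> ('a, 'k) chart" where
  "chart_at A p = (SOME c. c \<in> A \<and> p \<in> fst c)"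

definition frame_at ::
  "('a, 'k::finite) chart set \<Rightarrow> nat \<Rightarrow> (('a, 'k) chart \<Rightarrow> 'a \<Rightarrow> (real^'k) set) \<Rightarrow>
   (('a, 'k) chart \<Rightarrow> 'a \<Rightarrow> real^'k \<Rightarrow> real^'k \<Rightarrow> real) \<Rightarrow> 'a \<Rightarrow> nat \<Rightarrow> real^'k" where
  "frame_at A m H g p =
     (SOME e. (\<forall>i<m. e i \<in> H (chart_at A p) p) \<and>
        (\<forall>i<m. \<forall>j<m. g (chart_at A p) p (e i) (e j) = (if i = j then 1 else 0)))"


section \<open>Embedded submanifolds of Euclidean space with the induced metric\<close>

text \<open>Below, \<open>N\<close> stands for an embedded submanifold of the Euclidean space \<open>'b\<close>. Its tangent
  spaces are regarded as subspaces of \<open>'b\<close>, so that the induced metric is the restriction of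
  the inner product \<open>\<bullet>\<close>.\<close>

definition tangent_space :: "'b::euclidean_space set \<Rightarrow> 'b \<Rightarrow> 'b set" where
  "tangent_space N p =
     {v. \<exists>\<epsilon>>0. \<exists>\<gamma>::real \<Rightarrow> 'b. smooth_on {-\<epsilon><..<\<epsilon>} \<gamma> \<and> \<gamma> ` {-\<epsilon><..<\<epsilon>} \<subseteq> N \<and>
           \<gamma> 0 = p \<and> (\<gamma> has_vector_derivative v) (at 0)}"

definition smooth_on_submanifold ::
  "'b::euclidean_space set \<Rightarrow> ('b \<Rightarrow> 'c::euclidean_space) \<Rightarrow> bool" where
  "smooth_on_submanifold N Y \<longleftrightarrow>
     (\<forall>p\<in>N. \<exists>W F. open W \<and> p \<in> W \<and> smooth_on W F \<and> (\<forall>q\<in>N \<inter> W. F q = Y q))"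

definition vector_fields :: "'b::euclidean_space set \<Rightarrow> ('b \<Rightarrow> 'b) set" where
  "vector_fields N = {Y. smooth_on_submanifold N Y \<and> (\<forall>p\<in>N. Y p \<in> tangent_space N p)}"

text \<open>The derivative of \<open>Y\<close> at \<open>p\<close> in the direction \<open>v\<close>. The derivative within \<open>N\<close> is not
  unique as a linear map on \<open>'b\<close>, but its restriction to \<open>tangent_space N p\<close> is, and only
  tangent directions \<open>v\<close> are used.\<close>

definition dir_deriv ::
  "'b::euclidean_space set \<Rightarrow> ('b \<Rightarrow> 'c::euclidean_space) \<Rightarrow> 'b \<Rightarrow> 'b \<Rightarrow> 'c" where
  "dir_deriv N Y p v = frechet_derivative Y (at p within N) v"

text \<open>The coordinates of \<open>[X,Y]\<close> in \<open>'b\<close> are \<open>X(Y\<^sub>i) - Y(X\<^sub>i)\<close>, i.e. \<open>[X,Y]\<close> applied to the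
  coordinate functions.\<close>

definition lie_bracket ::
  "'b::euclidean_space set \<Rightarrow> ('b \<Rightarrow> 'b) \<Rightarrow> ('b \<Rightarrow> 'b) \<Rightarrow> 'b \<Rightarrow> 'b" where
  "lie_bracket N X Y p = dir_deriv N Y p (X p) - dir_deriv N X p (Y p)"

text \<open>\<open>D p v Y\<close> is the covariant derivative at \<open>p\<close> of the vector field \<open>Y\<close> in the direction
  \<open>v\<close>. The clauses say that \<open>D\<close> is an affine connection on \<open>N\<close>, torsion-free and compatible
  with the induced metric.\<close>

definition levi_civita_connection ::
  "'b::euclidean_space set \<Rightarrow> ('b \<Rightarrow> 'b \<Rightarrow> ('b \<Rightarrow> 'b) \<Rightarrow> 'b) \<Rightarrow> bool" where
  "levi_civita_connection N D \<longleftrightarrow>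
     (\<forall>X\<in>vector_fields N. \<forall>Y\<in>vector_fields N. (\<lambda>p. D p (X p) Y) \<in> vector_fields N) \<and>
     (\<forall>Y\<in>vector_fields N. \<forall>p\<in>N. \<forall>v\<in>tangent_space N p. \<forall>w\<in>tangent_space N p. \<forall>a b.
        D p (a *\<^sub>R v + b *\<^sub>R w) Y = a *\<^sub>R D p v Y + b *\<^sub>R D p w Y) \<and>
     (\<forall>Y\<in>vector_fields N. \<forall>Z\<in>vector_fields N. \<forall>p\<in>N. \<forall>v\<in>tangent_space N p.
        D p v (\<lambda>q. Y q + Z q) = D p v Y + D p v Z) \<and>
     (\<forall>Y\<in>vector_fields N. \<forall>\<phi>::'b \<Rightarrow> real. smooth_on_submanifold N \<phi> \<longrightarrow>
        (\<forall>p\<in>N. \<forall>v\<in>tangent_space N p.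
           D p v (\<lambda>q. \<phi> q *\<^sub>R Y q) = dir_deriv N \<phi> p v *\<^sub>R Y p + \<phi> p *\<^sub>R D p v Y)) \<and>
     (\<forall>X\<in>vector_fields N. \<forall>Y\<in>vector_fields N. \<forall>p\<in>N.
        D p (X p) Y - D p (Y p) X = lie_bracket N X Y p) \<and>
     (\<forall>Y\<in>vector_fields N. \<forall>Z\<in>vector_fields N. \<forall>p\<in>N. \<forall>v\<in>tangent_space N p.
        dir_deriv N (\<lambda>q. Y q \<bullet> Z q) p v = D p v Y \<bullet> Z p + Y p \<bullet> D p v Z)"

text \<open>\<open>R p u v w\<close> is \<open>R(u,v)w\<close> at \<open>p\<close>.\<close>

definition curvature_tensor ::
  "'b::euclidean_space set \<Rightarrow> ('b \<Rightarrow> 'b \<Rightarrow> ('b \<Rightarrow> 'b) \<Rightarrow> 'b) \<Rightarrow>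
   ('b \<Rightarrow> 'b \<Rightarrow> 'b \<Rightarrow> 'b \<Rightarrow> 'b) \<Rightarrow> bool" where
  "curvature_tensor N D R \<longleftrightarrow>
     (\<forall>X\<in>vector_fields N. \<forall>Y\<in>vector_fields N. \<forall>Z\<in>vector_fields N. \<forall>p\<in>N.
        R p (X p) (Y p) (Z p) =
          D p (X p) (\<lambda>q. D q (Y q) Z) - D p (Y p) (\<lambda>q. D q (X q) Z)
          - D p (lie_bracket N X Y p) Z)"


section \<open>Sections along a map and the pull-back connection\<close>

definition sections_along ::
  "('a, 'k::finite) chart set \<Rightarrow> 'b::euclidean_space set \<Rightarrow> ('a \<Rightarrow> 'b) \<Rightarrow> ('a \<Rightarrow> 'b) set" where
  "sections_along A N f = {V. smooth_map A V \<and> (\<forall>p. V p \<in> tangent_space N (f p))}"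

text \<open>\<open>P c p v V\<close> is the derivative of the section \<open>V\<close> of \<open>f\<^sup>-\<^sup>1TN\<close> in the direction of the
  tangent vector with coordinate vector \<open>v\<close> in the chart \<open>c\<close> at \<open>p\<close>. The pull-back of \<open>D\<close> is
  the unique connection on \<open>f\<^sup>-\<^sup>1TN\<close> that satisfies the last clause.\<close>

definition pullback_connection ::
  "('a, 'k::finite) chart set \<Rightarrow> 'b::euclidean_space set \<Rightarrow>
   ('b \<Rightarrow> 'b \<Rightarrow> ('b \<Rightarrow> 'b) \<Rightarrow> 'b) \<Rightarrow> ('a \<Rightarrow> 'b) \<Rightarrow>
   (('a, 'k) chart \<Rightarrow> 'a \<Rightarrow> real^'k \<Rightarrow> ('a \<Rightarrow> 'b) \<Rightarrow> 'b) \<Rightarrow> bool" where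
  "pullback_connection A N D f P \<longleftrightarrow>
     (\<forall>V\<in>sections_along A N f. \<forall>c\<in>A.
        (\<forall>v. smooth_on (snd c ` fst c) (\<lambda>x. P c (chart_inv c x) v V)) \<and>
        (\<forall>p\<in>fst c.
           (\<forall>v. P c p v V \<in> tangent_space N (f p)) \<and>
           linear (\<lambda>v. P c p v V) \<and>
           (\<forall>c'\<in>A. p \<in> fst c' \<longrightarrow> (\<forall>v. P c' p (transition c c' p v) V = P c p v V)) \<and>
           (\<forall>V'\<in>sections_along A N f. \<forall>v.
              P c p v (\<lambda>q. V q + V' q) = P c p v V + P c p v V') \<and>
           (\<forall>\<phi>::'a \<Rightarrow> real. smooth_map A \<phi> \<longrightarrow>
              (\<forall>v. P c p v (\<lambda>q. \<phi> q *\<^sub>R V q) =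
                     differential \<phi> c p v *\<^sub>R V p + \<phi> p *\<^sub>R P c p v V)))) \<and>
     (\<forall>Y\<in>vector_fields N. \<forall>c\<in>A. \<forall>p\<in>fst c. \<forall>v.
        P c p v (Y \<circ> f) = D (f p) (differential f c p v) Y)"

definition compactly_supported :: "('a::topological_space \<Rightarrow> 'b::zero) \<Rightarrow> bool" where
  "compactly_supported V \<longleftrightarrow> compact (closure {p. V p \<noteq> 0})"


section \<open>Exponentially subelliptic harmonic maps and their stability\<close>

text \<open>\<open>|df\<^sub>H|\<^sup>2\<close>; note \<open>df\<^sub>H = df\<close> on \<open>H\<close>.\<close>

definition norm_dH_sq ::
  "('a, 'k::finite) chart set \<Rightarrow> nat \<Rightarrow> (('a, 'k) chart \<Rightarrow> 'a \<Rightarrow> (real^'k) set) \<Rightarrow>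
   (('a, 'k) chart \<Rightarrow> 'a \<Rightarrow> real^'k \<Rightarrow> real^'k \<Rightarrow> real) \<Rightarrow>
   ('a \<Rightarrow> 'b::euclidean_space) \<Rightarrow> 'a \<Rightarrow> real" where
  "norm_dH_sq A m H g f p =
     (let df = differential f (chart_at A p) p; e = frame_at A m H g p
      in \<Sum>i<m. df (e i) \<bullet> df (e i))"

definition exp_energy ::
  "('a, 'k::finite) chart set \<Rightarrow> nat \<Rightarrow> (('a, 'k) chart \<Rightarrow> 'a \<Rightarrow> (real^'k) set) \<Rightarrow>
   (('a, 'k) chart \<Rightarrow> 'a \<Rightarrow> real^'k \<Rightarrow> real^'k \<Rightarrow> real) \<Rightarrow> 'a measure \<Rightarrow>
   ('a \<Rightarrow> 'b::euclidean_space) \<Rightarrow> real" where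
  "exp_energy A m H g vol f = (\<integral>p. exp (norm_dH_sq A m H g f p / 2) \<partial>vol)"

definition smooth_variation ::
  "('a, 'k::finite) chart set \<Rightarrow> 'b::euclidean_space set \<Rightarrow> ('a \<Rightarrow> 'b) \<Rightarrow>
   (real \<Rightarrow> 'a \<Rightarrow> 'b) \<Rightarrow> bool" where
  "smooth_variation A N f F \<longleftrightarrow>
     F 0 = f \<and>
     (\<exists>\<epsilon>>0. (\<forall>t\<in>{-\<epsilon><..<\<epsilon>}. range (F t) \<subseteq> N) \<and>
        (\<forall>c\<in>A. smooth_on ({-\<epsilon><..<\<epsilon>} \<times> snd c ` fst c) (\<lambda>(t, x). F t (chart_inv c x))))"

definition exp_subelliptic_harmonic ::
  "('a::topological_space, 'k::finite) chart set \<Rightarrow> nat \<Rightarrow>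
   (('a, 'k) chart \<Rightarrow> 'a \<Rightarrow> (real^'k) set) \<Rightarrow>
   (('a, 'k) chart \<Rightarrow> 'a \<Rightarrow> real^'k \<Rightarrow> real^'k \<Rightarrow> real) \<Rightarrow> 'a measure \<Rightarrow>
   'b::euclidean_space set \<Rightarrow> ('a \<Rightarrow> 'b) \<Rightarrow> bool" where
  "exp_subelliptic_harmonic A m H g vol N f \<longleftrightarrow>
     smooth_map A f \<and> range f \<subseteq> N \<and>
     (\<forall>F. smooth_variation A N f F \<and>
          compactly_supported (\<lambda>p. vector_derivative (\<lambda>t. F t p) (at 0)) \<longrightarrow>
          ((\<lambda>t. exp_energy A m H g vol (F t)) has_real_derivative 0) (at 0))"

text \<open>\<open>I\<^sub>H(V,V)\<close>, for the pull-back connection \<open>P\<close> along \<open>f\<close> and the curvature tensor \<open>R\<close> of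
  the target.\<close>

definition index_form ::
  "('a, 'k::finite) chart set \<Rightarrow> nat \<Rightarrow> (('a, 'k) chart \<Rightarrow> 'a \<Rightarrow> (real^'k) set) \<Rightarrow>
   (('a, 'k) chart \<Rightarrow> 'a \<Rightarrow> real^'k \<Rightarrow> real^'k \<Rightarrow> real) \<Rightarrow> 'a measure \<Rightarrow>
   (('a, 'k) chart \<Rightarrow> 'a \<Rightarrow> real^'k \<Rightarrow> ('a \<Rightarrow> 'b) \<Rightarrow> 'b) \<Rightarrow>
   ('b \<Rightarrow> 'b \<Rightarrow> 'b \<Rightarrow> 'b \<Rightarrow> 'b) \<Rightarrow> ('a \<Rightarrow> 'b::euclidean_space) \<Rightarrow> ('a \<Rightarrow> 'b) \<Rightarrow> real" where
  "index_form A m H g vol P R f V =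
     (\<integral>p. (let df = differential f (chart_at A p) p; e = frame_at A m H g p;
               DV = (\<lambda>v. P (chart_at A p) p v V)
           in exp (norm_dH_sq A m H g f p / 2) *
              ((\<Sum>i<m. DV (e i) \<bullet> df (e i))\<^sup>2
               + (\<Sum>i<m. DV (e i) \<bullet> DV (e i))
               - (\<Sum>i<m. R (f p) (df (e i)) (V p) (V p) \<bullet> df (e i)))) \<partial>vol)"

definition stable ::
  "('a::topological_space, 'k::finite) chart set \<Rightarrow> nat \<Rightarrow>
   (('a, 'k) chart \<Rightarrow> 'a \<Rightarrow> (real^'k) set) \<Rightarrow>
   (('a, 'k) chart \<Rightarrow> 'a \<Rightarrow> real^'k \<Rightarrow> real^'k \<Rightarrow> real) \<Rightarrow> 'a measure \<Rightarrow>
   'b::euclidean_space set \<Rightarrow>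
   (('a, 'k) chart \<Rightarrow> 'a \<Rightarrow> real^'k \<Rightarrow> ('a \<Rightarrow> 'b) \<Rightarrow> 'b) \<Rightarrow>
   ('b \<Rightarrow> 'b \<Rightarrow> 'b \<Rightarrow> 'b \<Rightarrow> 'b) \<Rightarrow> ('a \<Rightarrow> 'b) \<Rightarrow> bool" where
  "stable A m H g vol N P R f \<longleftrightarrow>
     (\<forall>V\<in>sections_along A N f. compactly_supported V \<longrightarrow> index_form A m H g vol P R f V \<ge> 0)"

abbreviation "unstable A m H g vol N P R f \<equiv> \<not> stable A m H g vol N P R f"

end

theory Submission
  imports Defs
begin

text \<open>The index form is averaged over the projections to the sphere of the constant vector
  fields of the ambient space. For a vector \<open>a\<close> let \<open>X\<^sub>a(q) = a - (a \<bullet> q) q\<close> and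
  \<open>V\<^sub>a = X\<^sub>a \<circ> f\<close>. The Levi-Civita connection of the sphere gives \<open>D\<^sub>w X\<^sub>a = - (a \<bullet> p) w\<close> at \<open>p\<close>
  (\<open>levi_civita_sphere_proj_field\<close>), so the pull-back connection differentiates \<open>V\<^sub>a\<close> in the
  direction \<open>e\<^sub>i\<close> to \<open>- (a \<bullet> f) df(e\<^sub>i)\<close>, and the curvature is that of a space of constant curvature
  one (\<open>curvature_sphere\<close>). With \<open>s = |df\<^sub>H|\<^sup>2\<close> the integrand of \<open>I\<^sub>H(V\<^sub>a, V\<^sub>a)\<close> therefore is
  \<open>exp (s/2)\<close> times
  \<open>(a \<bullet> f)\<^sup>2 s\<^sup>2 + (a \<bullet> f)\<^sup>2 s - (|a|\<^sup>2 - (a \<bullet> f)\<^sup>2) s + \<Sum>\<^sub>i (a \<bullet> df(e\<^sub>i))\<^sup>2\<close>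
  (\<open>index_form_proj_field\<close>). Let \<open>a\<close> run through an orthonormal basis of the ambient space of
  dimension \<open>n + 1\<close>. As \<open>|f| = 1\<close>, the sum of the integrands is \<open>exp (s/2)\<close> times
  \<open>s\<^sup>2 + s - n s + s = s (s - (n - 2))\<close>, whose integral is negative by hypothesis. Hence
  \<open>I\<^sub>H(V\<^sub>a, V\<^sub>a) < 0\<close> for some \<open>a\<close>.

  Exchanging the sum with the integral needs every single integrand to be integrable. The
  integrands are continuous: \<open>|d\<phi>\<^sub>H|\<^sup>2\<close> does not depend on the chart and the frame chosen at each
  point (\<open>norm_dH_sq_eq\<close>), so it may be computed in a continuous frame obtained by Gram-Schmidt
  orthonormalisation (\<open>continuous_norm_dH_sq\<close>). On a compact manifold they are bounded, and the
  volume is finite (\<open>finite_measure_riemannian_volume\<close>).\<close>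

section \<open>Calculus of smooth maps\<close>

lemma Ck_on_cong:
  assumes "open S" and "Ck_on k S f" and "\<And>x. x \<in> S \<Longrightarrow> f x = g x"
  shows "Ck_on k S g"
  using assms
proof (induction k arbitrary: f g)
  case 0
  then show ?case by (simp cong: continuous_on_cong)
next
  case (Suc k)
  have der: "(g has_derivative L) (at x)" if "(f has_derivative L) (at x)" "x \<in> S" for x L
    using has_derivative_transform_within_open[OF that(1) Suc.prems(1) that(2)] Suc.prems(3) by auto
  have fd: "f differentiable (at x)" if "x \<in> S" for x
    using Suc.prems(1,2) that by (simp add: differentiable_on_eq_differentiable_at)
  have frd: "frechet_derivative f (at x) = frechet_derivative g (at x)" if "x \<in> S" for x
    using der[OF fd[OF that, unfolded frechet_derivative_works] that] frechet_derivative_at by blast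
  have "g differentiable (at x)" if "x \<in> S" for x
    using der fd that unfolding differentiable_def by blast
  moreover have "Ck_on k S (\<lambda>x. frechet_derivative g (at x) v)" for v
    by (rule Suc.IH[OF Suc.prems(1), of "\<lambda>x. frechet_derivative f (at x) v"])
       (use Suc.prems(2) frd in auto)
  ultimately show ?case
    using Suc.prems(1) by (simp add: differentiable_on_eq_differentiable_at)
qed

lemma Ck_on_SucI:
  assumes "open S" and "\<And>x. x \<in> S \<Longrightarrow> (f has_derivative L x) (at x)"
    and "\<And>v. Ck_on k S (\<lambda>x. L x v)"
  shows "Ck_on (Suc k) S f"
proof -
  have "f differentiable_on S"
    using assms(1,2) by (auto simp: differentiable_on_eq_differentiable_at differentiable_def)
  moreover have "Ck_on k S (\<lambda>x. frechet_derivative f (at x) v)" for v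
    by (rule Ck_on_cong[OF assms(1) assms(3)[of v]])
       (use assms(2) frechet_derivative_at in metis)
  ultimately show ?thesis by simp
qed

lemma Ck_on_Suc_has_derivative:
  assumes "open S" and "Ck_on (Suc k) S f" and "x \<in> S"
  shows "(f has_derivative frechet_derivative f (at x)) (at x)"
  using assms by (simp add: differentiable_on_eq_differentiable_at frechet_derivative_works)

lemma Ck_on_Suc_imp_Ck_on: "Ck_on (Suc k) S f \<Longrightarrow> Ck_on k S f"
proof (induction k arbitrary: f)
  case 0
  then show ?case by (simp add: differentiable_imp_continuous_on)
next
  case (Suc k)
  then show ?case by (metis Ck_on.simps(2))
qed

lemma Ck_on_const: "open S \<Longrightarrow> Ck_on k S (\<lambda>x. c)"
proof (induction k arbitrary: c)
  case (Suc k)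
  then show ?case by (intro Ck_on_SucI[where L = "\<lambda>x v. 0"]) auto
qed simp

lemma Ck_on_bounded_linear:
  assumes "open S" and "bounded_linear f"
  shows "Ck_on k S f"
proof (cases k)
  case 0
  then show ?thesis using assms(2) by (simp add: linear_continuous_on)
next
  case (Suc j)
  show ?thesis unfolding Suc
    by (rule Ck_on_SucI[where L = "\<lambda>x. f"])
       (use assms in \<open>auto intro: bounded_linear_imp_has_derivative Ck_on_const\<close>)
qed

lemma Ck_on_add:
  assumes "open S" and "Ck_on k S f" and "Ck_on k S g"
  shows "Ck_on k S (\<lambda>x. f x + g x)"
  using assms(2,3)
proof (induction k arbitrary: f g)
  case 0
  then show ?case by (simp add: continuous_on_add)
next
  case (Suc k)
  show ?case
    by (rule Ck_on_SucI[OF assms(1) has_derivative_add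
          [OF Ck_on_Suc_has_derivative[OF assms(1) Suc.prems(1)]
              Ck_on_Suc_has_derivative[OF assms(1) Suc.prems(2)]]])
       (use Suc in auto)
qed

lemma Ck_on_bilinear:
  assumes "open S" and bil: "bounded_bilinear h" and "Ck_on k S f" and "Ck_on k S g"
  shows "Ck_on k S (\<lambda>x. h (f x) (g x))"
  using assms(3,4)
proof (induction k arbitrary: f g)
  case 0
  then show ?case by (simp add: bounded_bilinear.continuous_on[OF bil])
next
  case (Suc k)
  show ?case
  proof (rule Ck_on_SucI[OF assms(1) bounded_bilinear.FDERIV[OF bil
          Ck_on_Suc_has_derivative[OF assms(1) Suc.prems(1)]
          Ck_on_Suc_has_derivative[OF assms(1) Suc.prems(2)]]])
    fix v
    show "Ck_on k S (\<lambda>x. h (f x) (frechet_derivative g (at x) v)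
                          + h (frechet_derivative f (at x) v) (g x))"
      by (intro Ck_on_add[OF assms(1)] Suc.IH)
         (use Suc.prems Ck_on_Suc_imp_Ck_on in auto)
  qed
qed

text \<open>Great circles are the curves that realise all tangent vectors of the sphere. Derivatives of a
  curve of this form have the same form, with other \<open>p\<close> and \<open>v\<close>; this closes the induction.\<close>

lemma Ck_on_rotation:
  fixes p v :: "'b::euclidean_space"
  assumes "open S"
  shows "Ck_on k S (\<lambda>t::real. cos (r * t) *\<^sub>R p + sin (r * t) *\<^sub>R v)"
proof (induction k arbitrary: p v)
  case 0
  then show ?case by (auto intro!: continuous_intros)
next
  case (Suc k)
  show ?case
  proof (rule Ck_on_SucI[OF assms,
        where L = "\<lambda>t h. cos (r * t) *\<^sub>R ((h * r) *\<^sub>R v) + sin (r * t) *\<^sub>R (- (h * r) *\<^sub>R p)"])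
    fix t :: real
    show "((\<lambda>t. cos (r * t) *\<^sub>R p + sin (r * t) *\<^sub>R v) has_derivative
        (\<lambda>h. cos (r * t) *\<^sub>R ((h * r) *\<^sub>R v) + sin (r * t) *\<^sub>R (- (h * r) *\<^sub>R p))) (at t)"
      by (rule derivative_eq_intros refl)+ (simp add: fun_eq_iff algebra_simps)
  qed (rule Suc.IH)
qed


section \<open>The Levi-Civita connection and the curvature of the unit sphere\<close>

text \<open>A derivative of \<open>Y\<close> within a submanifold is not unique, but on the velocity of a curve in \<open>N\<close>
  any such derivative must give the derivative of \<open>Y\<close> along the curve. So any derivative at hand
  computes \<open>dir_deriv\<close> in tangent directions.\<close>

lemma dir_deriv_eq:
  assumes "v \<in> tangent_space N p" and "(Y has_derivative L) (at p within N)"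
  shows "dir_deriv N Y p v = L v"
proof -
  obtain \<epsilon> \<gamma> where \<gamma>: "\<epsilon> > 0" "\<gamma> ` {-\<epsilon><..<\<epsilon>} \<subseteq> N" "\<gamma> 0 = p"
    "(\<gamma> has_vector_derivative v) (at (0::real))"
    using assms(1) by (auto simp: tangent_space_def)
  have along: "((Y \<circ> \<gamma>) has_vector_derivative K v) (at 0)"
    if K: "(Y has_derivative K) (at p within N)" for K
  proof -
    let ?I = "{-\<epsilon><..<\<epsilon>}"
    have "(\<gamma> has_derivative (\<lambda>h. h *\<^sub>R v)) (at 0 within ?I)"
      using \<gamma>(4) by (auto simp: has_vector_derivative_def intro: has_derivative_at_withinI)
    moreover have "(Y has_derivative K) (at (\<gamma> 0) within \<gamma> ` ?I)"
      using K \<gamma>(2,3) by (auto intro: has_derivative_subset)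
    ultimately have "((Y \<circ> \<gamma>) has_derivative (K \<circ> (\<lambda>h. h *\<^sub>R v))) (at 0 within ?I)"
      by (rule diff_chain_within)
    moreover have "K \<circ> (\<lambda>h. h *\<^sub>R v) = (\<lambda>h. h *\<^sub>R K v)"
      using has_derivative_linear[OF K] by (auto simp: linear_cmul)
    ultimately show ?thesis
      using \<gamma>(1) by (simp add: has_vector_derivative_def at_within_open[of 0 ?I])
  qed
  have "(Y has_derivative frechet_derivative Y (at p within N)) (at p within N)"
    using assms(2) frechet_derivative_works differentiable_def by blast
  from along[OF this] along[OF assms(2)] show ?thesis
    unfolding dir_deriv_def by (rule vector_derivative_unique_at)
qed

lemma
  assumes "levi_civita_connection N D"
  shows levi_civita_vector_field: "\<And>X Y. \<lbrakk>X \<in> vector_fields N; Y \<in> vector_fields N\<rbrakk> \<Longrightarrow>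
      (\<lambda>p. D p (X p) Y) \<in> vector_fields N"
    and levi_civita_leibniz: "\<And>Y \<phi> p v. \<lbrakk>Y \<in> vector_fields N; smooth_on_submanifold N \<phi>;
      p \<in> N; v \<in> tangent_space N p\<rbrakk> \<Longrightarrow>
      D p v (\<lambda>q. \<phi> q *\<^sub>R Y q) = dir_deriv N \<phi> p v *\<^sub>R Y p + \<phi> p *\<^sub>R D p v Y"
    and levi_civita_torsion_free: "\<And>X Y p. \<lbrakk>X \<in> vector_fields N; Y \<in> vector_fields N; p \<in> N\<rbrakk> \<Longrightarrow>
      D p (X p) Y - D p (Y p) X = lie_bracket N X Y p"
    and levi_civita_metric: "\<And>Y Z p v. \<lbrakk>Y \<in> vector_fields N; Z \<in> vector_fields N;
      p \<in> N; v \<in> tangent_space N p\<rbrakk> \<Longrightarrow>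
      dir_deriv N (\<lambda>q. Y q \<bullet> Z q) p v = D p v Y \<bullet> Z p + Y p \<bullet> D p v Z"
  using assms unfolding levi_civita_connection_def by simp_all

text \<open>A connection takes vector fields as functions on the whole ambient space, and fields that agree
  on \<open>N\<close> may differ elsewhere. Multiplication with the indicator function of \<open>N\<close> makes them equal
  as functions; by the Leibniz rule it leaves the covariant derivative unchanged, since this
  function is smooth along \<open>N\<close> with vanishing derivative.\<close>

lemma levi_civita_local:
  assumes LC: "levi_civita_connection N D"
    and Y: "Y \<in> vector_fields N" and Y': "Y' \<in> vector_fields N"
    and eq: "\<And>q. q \<in> N \<Longrightarrow> Y q = Y' q"
    and p: "p \<in> N" and v: "v \<in> tangent_space N p"
  shows "D p v Y = D p v Y'"
proof -
  define \<phi> :: "'a \<Rightarrow> real" where "\<phi> q = (if q \<in> N then 1 else 0)" for q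
  have "smooth_on UNIV (\<lambda>q::'a. 1::real)"
    by (simp add: smooth_on_def Ck_on_const)
  then have sm: "smooth_on_submanifold N \<phi>"
    unfolding smooth_on_submanifold_def \<phi>_def by (intro ballI exI[of _ UNIV] exI[of _ "\<lambda>q. 1"]) auto
  have "(\<phi> has_derivative (\<lambda>h. 0)) (at p within N)"
    by (rule has_derivative_transform[OF p _ has_derivative_const[of 1]]) (simp add: \<phi>_def)
  then have d0: "dir_deriv N \<phi> p v = 0"
    using dir_deriv_eq[OF v] by auto
  have *: "D p v (\<lambda>q. \<phi> q *\<^sub>R Z q) = D p v Z" if "Z \<in> vector_fields N" for Z
  proof -
    have "D p v (\<lambda>q. \<phi> q *\<^sub>R Z q) = dir_deriv N \<phi> p v *\<^sub>R Z p + \<phi> p *\<^sub>R D p v Z"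
      by (rule levi_civita_leibniz[OF LC that sm p v])
    then show ?thesis using d0 p by (simp add: \<phi>_def)
  qed
  have "(\<lambda>q. \<phi> q *\<^sub>R Y q) = (\<lambda>q. \<phi> q *\<^sub>R Y' q)"
    using eq by (auto simp: \<phi>_def)
  then show ?thesis using *[OF Y] *[OF Y'] by simp
qed

text \<open>Differentiating \<open>q \<bullet> q = 1\<close> along the sphere gives one inclusion, great circles give the
  other.\<close>

lemma tangent_space_sphere:
  fixes p :: "'b::euclidean_space"
  assumes "p \<in> sphere 0 1"
  shows "tangent_space (sphere 0 1) p = {v. v \<bullet> p = 0}"
proof (intro set_eqI iffI)
  fix v assume "v \<in> tangent_space (sphere 0 1) p"
  then have v: "v \<in> tangent_space (sphere 0 1) p" .
  have "((\<lambda>q. q \<bullet> q) has_derivative (\<lambda>h. p \<bullet> h + h \<bullet> p)) (at p within sphere 0 1)"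
    by (rule derivative_eq_intros refl)+
  then have "dir_deriv (sphere 0 1) (\<lambda>q. q \<bullet> q) p v = p \<bullet> v + v \<bullet> p"
    using dir_deriv_eq[OF v] by blast
  moreover have "((\<lambda>q. q \<bullet> q) has_derivative (\<lambda>h. 0)) (at p within sphere 0 1)"
    by (rule has_derivative_transform[OF assms _ has_derivative_const[of 1]])
       (simp add: norm_eq_1)
  then have "dir_deriv (sphere 0 1) (\<lambda>q. q \<bullet> q) p v = 0"
    using dir_deriv_eq[OF v] by auto
  ultimately show "v \<in> {v. v \<bullet> p = 0}" by (simp add: inner_commute)
next
  fix v assume "v \<in> {v. v \<bullet> p = 0}"
  then have vp: "v \<bullet> p = 0" by simp
  (* sgn 0 = 0 makes the great circle through p constant when v = 0 *)
  define u where "u = sgn v"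
  define \<gamma> where "\<gamma> t = cos (norm v * t) *\<^sub>R p + sin (norm v * t) *\<^sub>R u" for t
  have up: "u \<bullet> p = 0" "p \<bullet> u = 0" and nu: "norm v *\<^sub>R u = v"
    using vp by (cases "v = 0"; simp add: u_def sgn_div_norm inner_commute)+
  have pp: "p \<bullet> p = 1" using assms by (simp add: norm_eq_1)
  have "\<gamma> t \<bullet> \<gamma> t = (cos (norm v * t))\<^sup>2 + (sin (norm v * t))\<^sup>2 * (u \<bullet> u)" for t
    by (simp add: \<gamma>_def inner_add_left inner_add_right up pp power2_eq_square)
  moreover have "u \<bullet> u = 1" if "v \<noteq> 0"
    using that by (simp add: u_def norm_sgn flip: norm_eq_1)
  ultimately have "\<gamma> t \<bullet> \<gamma> t = 1" for t
    by (cases "v = 0") auto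
  then have on: "\<gamma> t \<in> sphere 0 1" for t by (simp add: norm_eq_1)
  have "(\<gamma> has_vector_derivative norm v *\<^sub>R u) (at 0)"
    unfolding \<gamma>_def has_vector_derivative_def
    by (rule derivative_eq_intros refl)+ (simp add: fun_eq_iff)
  moreover have "smooth_on {-1<..<1} \<gamma>"
    unfolding smooth_on_def \<gamma>_def by (simp add: Ck_on_rotation)
  moreover have "\<gamma> 0 = p" by (simp add: \<gamma>_def)
  ultimately show "v \<in> tangent_space (sphere 0 1) p"
    unfolding tangent_space_def using on nu by (auto intro!: exI[of _ 1] exI[of _ \<gamma>])
qed

text \<open>On the unit sphere this is the tangential projection of the constant field \<open>a\<close>.\<close>

definition proj_field :: "'b::euclidean_space \<Rightarrow> 'b \<Rightarrow> 'b" where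
  "proj_field a q = a - (a \<bullet> q) *\<^sub>R q"

lemma smooth_on_proj_field_comp:
  assumes "open S" and "smooth_on S F"
  shows "smooth_on S (\<lambda>x. proj_field a (F x))"
  unfolding smooth_on_def
proof
  fix k
  have F: "Ck_on k S F" using assms(2) by (simp add: smooth_on_def)
  have "Ck_on k S (\<lambda>x. a + ((- a) \<bullet> F x) *\<^sub>R F x)"
    by (intro Ck_on_add Ck_on_bilinear[OF _ bounded_bilinear_scaleR]
        Ck_on_bilinear[OF _ bounded_bilinear_inner] Ck_on_const F assms(1))
  then show "Ck_on k S (\<lambda>x. proj_field a (F x))"
    by (simp add: proj_field_def)
qed

lemma smooth_on_ident: "open S \<Longrightarrow> smooth_on S (\<lambda>x. x)"
  by (simp add: smooth_on_def Ck_on_bounded_linear)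

lemma smooth_on_submanifoldI: "smooth_on UNIV F \<Longrightarrow> smooth_on_submanifold N F"
  unfolding smooth_on_submanifold_def by (intro ballI exI[of _ UNIV] exI[of _ F]) auto

lemma proj_field_tangent:
  "q \<in> sphere 0 1 \<Longrightarrow> proj_field a q \<in> tangent_space (sphere 0 1) q"
  by (simp add: tangent_space_sphere proj_field_def inner_diff_left norm_eq_1)

lemma proj_field_vector_field: "proj_field a \<in> vector_fields (sphere 0 1)"
  using smooth_on_proj_field_comp[OF open_UNIV smooth_on_ident, of a]
  by (auto simp: vector_fields_def proj_field_tangent intro: smooth_on_submanifoldI)

lemma proj_field_fix: "a \<bullet> p = 0 \<Longrightarrow> proj_field a p = a"
  by (simp add: proj_field_def)

lemma proj_field_inner_tangent: "w \<bullet> p = 0 \<Longrightarrow> proj_field a p \<bullet> w = a \<bullet> w"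
  by (simp add: proj_field_def inner_diff_left inner_commute[of p w])

lemma dir_deriv_proj_field:
  assumes "v \<in> tangent_space (sphere 0 1) p"
  shows "dir_deriv (sphere 0 1) (proj_field a) p v = - ((a \<bullet> v) *\<^sub>R p + (a \<bullet> p) *\<^sub>R v)"
proof -
  have "(proj_field a has_derivative (\<lambda>v. - ((a \<bullet> v) *\<^sub>R p + (a \<bullet> p) *\<^sub>R v))) (at p within sphere 0 1)"
    unfolding proj_field_def by (rule derivative_eq_intros refl)+ (simp add: fun_eq_iff)
  from dir_deriv_eq[OF assms this] show ?thesis .
qed

lemma lie_bracket_proj_field:
  assumes "p \<in> sphere 0 1"
  shows "lie_bracket (sphere 0 1) (proj_field a) (proj_field b) p
    = (a \<bullet> p) *\<^sub>R proj_field b p - (b \<bullet> p) *\<^sub>R proj_field a p"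
proof -
  have "b \<bullet> proj_field a p = a \<bullet> proj_field b p"
    by (simp add: proj_field_def inner_diff_right inner_commute)
  then show ?thesis
    unfolding lie_bracket_def
    by (simp add: dir_deriv_proj_field[OF proj_field_tangent[OF assms]] del: mem_sphere_0)
qed

lemma dir_deriv_inner_proj_field:
  assumes "p \<in> sphere 0 1" and "v \<in> tangent_space (sphere 0 1) p"
  shows "dir_deriv (sphere 0 1) (\<lambda>q. proj_field b q \<bullet> proj_field c q) p v
    = - ((b \<bullet> p) * (v \<bullet> proj_field c p) + (c \<bullet> p) * (proj_field b p \<bullet> v))"
proof -
  have vp: "v \<bullet> p = 0" "p \<bullet> v = 0" and pp: "p \<bullet> p = 1"
    using assms by (auto simp: tangent_space_sphere norm_eq_1 inner_commute)
  have "((\<lambda>q. proj_field b q \<bullet> proj_field c q) has_derivative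
      (\<lambda>v. proj_field b p \<bullet> (- ((c \<bullet> v) *\<^sub>R p + (c \<bullet> p) *\<^sub>R v))
           + (- ((b \<bullet> v) *\<^sub>R p + (b \<bullet> p) *\<^sub>R v)) \<bullet> proj_field c p)) (at p within sphere 0 1)"
    unfolding proj_field_def
    by (rule derivative_eq_intros refl)+ (simp add: fun_eq_iff algebra_simps)
  from dir_deriv_eq[OF assms(2) this] show ?thesis
    using vp pp by (simp add: proj_field_def algebra_simps inner_diff_left inner_diff_right inner_commute)
qed

text \<open>This is the uniqueness part of the fundamental theorem of Riemannian geometry, for the fields
  \<open>X\<^sub>a\<close> only: the difference \<open>T\<close> between the given connection and the expected value is symmetric
  because both are torsion-free, and skew because both are metric. A trilinear form that is
  symmetric in the first two and skew in the last two arguments vanishes.\<close>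

lemma levi_civita_sphere_proj_field:
  assumes LC: "levi_civita_connection (sphere 0 1) D"
    and p: "p \<in> sphere 0 1" and w: "w \<bullet> p = 0"
  shows "D p w (proj_field a) = - (a \<bullet> p) *\<^sub>R w"
proof -
  let ?N = "sphere 0 1 :: 'a set"
  define T where "T a b = D p (proj_field a p) (proj_field b) + (b \<bullet> p) *\<^sub>R proj_field a p" for a b
  note VF = proj_field_vector_field
  have sym: "T b c = T c b" for b c
  proof -
    have "D p (proj_field b p) (proj_field c) - D p (proj_field c p) (proj_field b)
      = lie_bracket ?N (proj_field b) (proj_field c) p"
      by (rule levi_civita_torsion_free[OF LC VF VF p])
    then show ?thesis
      by (simp add: T_def lie_bracket_proj_field[OF p] algebra_simps)
  qed
  have skew: "T u b \<bullet> proj_field c p = - (T u c \<bullet> proj_field b p)" for u b c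
  proof -
    have t: "proj_field u p \<in> tangent_space ?N p" using p by (rule proj_field_tangent)
    have "dir_deriv ?N (\<lambda>q. proj_field b q \<bullet> proj_field c q) p (proj_field u p)
      = D p (proj_field u p) (proj_field b) \<bullet> proj_field c p
        + proj_field b p \<bullet> D p (proj_field u p) (proj_field c)"
      by (rule levi_civita_metric[OF LC VF VF p t])
    then show ?thesis
      by (simp add: dir_deriv_inner_proj_field[OF p t] T_def inner_add_left inner_add_right inner_commute)
  qed
  (* six alternating applications of the two symmetries return to the start with the sign reversed *)
  have zero: "T b c \<bullet> proj_field d p = 0" for b c d
    using skew[of b c d] skew[of d b c] skew[of c d b] sym[of b d] sym[of d c] sym[of c b] by simp
  have "(\<lambda>q. D q (proj_field w q) (proj_field a)) \<in> vector_fields ?N"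
    by (rule levi_civita_vector_field[OF LC VF VF])
  then have "D p (proj_field w p) (proj_field a) \<bullet> p = 0"
    using p by (auto simp: vector_fields_def tangent_space_sphere)
  then have "T w a \<bullet> p = 0"
    using w by (simp add: T_def inner_add_left proj_field_fix)
  then have "T w a \<bullet> T w a = 0"
    using zero[of w a "T w a"] by (simp add: proj_field_fix)
  then show ?thesis
    using w by (simp add: T_def proj_field_fix eq_neg_iff_add_eq_0)
qed

text \<open>All vectors are extended by the fields \<open>X\<^sub>u\<close>, \<open>X\<^sub>v\<close>; since \<open>u\<close> and \<open>v\<close> are tangent at \<open>p\<close>, the
  bracket of the extensions and the first covariant derivatives vanish at \<open>p\<close>. By the
  Leibniz rule only the derivative of the coefficient \<open>- (v \<bullet> q)\<close> of \<open>D\<^sub>w X\<^sub>v = - (v \<bullet> q) w\<close> survives in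
  the second covariant derivatives.\<close>

lemma curvature_sphere:
  assumes LC: "levi_civita_connection (sphere 0 1) D"
    and curv: "curvature_tensor (sphere 0 1) D R"
    and p: "p \<in> sphere 0 1" and u: "u \<bullet> p = 0" and v: "v \<bullet> p = 0"
  shows "R p u v v = (v \<bullet> v) *\<^sub>R u - (u \<bullet> v) *\<^sub>R v"
proof -
  let ?N = "sphere 0 1 :: 'a set"
  note VF = proj_field_vector_field
  note [simp] = proj_field_fix[OF u] proj_field_fix[OF v]
  have tg: "w \<in> tangent_space ?N p" if "w \<bullet> p = 0" for w
    using that p by (simp add: tangent_space_sphere)
  have second: "D p w (\<lambda>q. D q (proj_field b q) (proj_field v)) = - (v \<bullet> w) *\<^sub>R b"
    if w: "w \<bullet> p = 0" and b: "b \<bullet> p = 0" for w b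
  proof -
    define \<phi> where "\<phi> q = - (v \<bullet> q)" for q
    have bl: "bounded_linear \<phi>"
      unfolding \<phi>_def by (intro bounded_linear_minus bounded_linear_inner_right)
    have sm: "smooth_on_submanifold ?N \<phi>"
      using bl by (auto intro: smooth_on_submanifoldI simp: smooth_on_def Ck_on_bounded_linear)
    have eq: "D q (proj_field b q) (proj_field v) = \<phi> q *\<^sub>R proj_field b q" if "q \<in> ?N" for q
      using levi_civita_sphere_proj_field[OF LC that, of "proj_field b q" v] proj_field_tangent[OF that, of b]
      by (simp add: \<phi>_def tangent_space_sphere[OF that] del: mem_sphere_0)
    (* the identity eq holds on the sphere only, so locality is needed to differentiate it *)
    have Y: "(\<lambda>q. D q (proj_field b q) (proj_field v)) \<in> vector_fields ?N"
      by (rule levi_civita_vector_field[OF LC VF VF])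
    have "smooth_on UNIV (\<lambda>q. \<phi> q *\<^sub>R proj_field b q)"
      using smooth_on_proj_field_comp[OF open_UNIV smooth_on_ident, of b] bl
      unfolding smooth_on_def
      by (intro allI Ck_on_bilinear[OF _ bounded_bilinear_scaleR])
         (auto intro: Ck_on_bounded_linear)
    moreover have "\<phi> q *\<^sub>R proj_field b q \<in> tangent_space ?N q" if "q \<in> ?N" for q
      using proj_field_tangent[OF that, of b] that by (simp add: tangent_space_sphere)
    ultimately have Y': "(\<lambda>q. \<phi> q *\<^sub>R proj_field b q) \<in> vector_fields ?N"
      by (auto simp: vector_fields_def intro: smooth_on_submanifoldI)
    have "D p w (\<lambda>q. D q (proj_field b q) (proj_field v)) = D p w (\<lambda>q. \<phi> q *\<^sub>R proj_field b q)"
      by (rule levi_civita_local[OF LC Y Y' eq p tg[OF w]])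
    also have "\<dots> = dir_deriv ?N \<phi> p w *\<^sub>R proj_field b p + \<phi> p *\<^sub>R D p w (proj_field b)"
      by (rule levi_civita_leibniz[OF LC VF sm p tg[OF w]])
    also have "dir_deriv ?N \<phi> p w = \<phi> w"
      by (rule dir_deriv_eq[OF tg[OF w]]) (rule bounded_linear_imp_has_derivative[OF bl])
    finally show ?thesis using v b by (simp add: \<phi>_def proj_field_fix)
  qed
  have "lie_bracket ?N (proj_field u) (proj_field v) p = 0"
    using u v by (simp add: lie_bracket_proj_field[OF p])
  moreover have "D p 0 (proj_field v) = 0"
    using levi_civita_sphere_proj_field[OF LC p, of 0 v] by simp
  moreover have "R p (proj_field u p) (proj_field v p) (proj_field v p)
      = D p (proj_field u p) (\<lambda>q. D q (proj_field v q) (proj_field v))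
        - D p (proj_field v p) (\<lambda>q. D q (proj_field u q) (proj_field v))
        - D p (lie_bracket ?N (proj_field u) (proj_field v) p) (proj_field v)"
    using curv[unfolded curvature_tensor_def, rule_format, OF VF VF VF p] .
  ultimately show ?thesis
    using second[OF u v] second[OF v u] by (simp add: inner_commute)
qed


section \<open>Coordinates\<close>

lemma
  assumes "smooth_atlas A" and "c \<in> A"
  shows open_chart_domain: "open (fst c)"
    and open_chart_image: "open (snd c ` fst c)"
    and continuous_on_chart: "continuous_on (fst c) (snd c)"
    and continuous_on_chart_inv: "continuous_on (snd c ` fst c) (chart_inv c)"
    and chart_inv_chart: "p \<in> fst c \<Longrightarrow> chart_inv c (snd c p) = p"
  using assms by (auto simp: smooth_atlas_def homeomorphism_def)

lemma chart_cover: "smooth_atlas A \<Longrightarrow> \<exists>c\<in>A. p \<in> fst c"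
  by (force simp: smooth_atlas_def)

lemma chart_at:
  assumes "smooth_atlas A"
  shows "chart_at A p \<in> A" and "p \<in> fst (chart_at A p)"
  using someI_ex[of "\<lambda>c. c \<in> A \<and> p \<in> fst c"] chart_cover[OF assms, of p]
  unfolding chart_at_def by blast+

lemma open_chart_overlap:
  assumes "smooth_atlas A" and "c \<in> A" and "c' \<in> A"
  shows "open (snd c ` (fst c \<inter> fst c'))"
proof -
  have "open (chart_inv c -` fst c' \<inter> snd c ` fst c)"
    using continuous_on_chart_inv[OF assms(1,2)] open_chart_image[OF assms(1,2)]
      open_chart_domain[OF assms(1,3)] by (simp add: continuous_on_open_vimage)
  moreover have "chart_inv c -` fst c' \<inter> snd c ` fst c = snd c ` (fst c \<inter> fst c')"
    using chart_inv_chart[OF assms(1,2)] by auto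
  ultimately show ?thesis by simp
qed

lemma transition_has_derivative:
  assumes at: "smooth_atlas A" and c: "c \<in> A" and c': "c' \<in> A"
    and p: "p \<in> fst c" "p \<in> fst c'"
  shows "((snd c' \<circ> chart_inv c) has_derivative transition c c' p) (at (snd c p))"
proof -
  have "Ck_on (Suc 0) (snd c ` (fst c \<inter> fst c')) (snd c' \<circ> chart_inv c)"
    using at c c' unfolding smooth_atlas_def smooth_on_def by blast
  from Ck_on_Suc_has_derivative[OF open_chart_overlap[OF at c c'] this, of "snd c p"] p
  show ?thesis unfolding transition_def by auto
qed

lemma differential_has_derivative:
  assumes at: "smooth_atlas A" and c: "c \<in> A" and sm: "smooth_map A \<phi>" and p: "p \<in> fst c"
  shows "((\<phi> \<circ> chart_inv c) has_derivative differential \<phi> c p) (at (snd c p))"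
proof -
  have "Ck_on (Suc 0) (snd c ` fst c) (\<phi> \<circ> chart_inv c)"
    using sm c unfolding smooth_map_def smooth_on_def by blast
  from Ck_on_Suc_has_derivative[OF open_chart_image[OF at c] this, of "snd c p"] p
  show ?thesis unfolding differential_def by auto
qed

text \<open>The chain rule for \<open>\<phi> \<circ> c\<inverse> = (\<phi> \<circ> c'\<inverse>) \<circ> (c' \<circ> c\<inverse>)\<close>.\<close>

lemma differential_transition:
  assumes at: "smooth_atlas A" and c: "c \<in> A" and c': "c' \<in> A" and sm: "smooth_map A \<phi>"
    and p: "p \<in> fst c" "p \<in> fst c'"
  shows "differential \<phi> c' p (transition c c' p v) = differential \<phi> c p v"
proof -
  have "(snd c' \<circ> chart_inv c) (snd c p) = snd c' p"
    using chart_inv_chart[OF at c p(1)] by simp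
  then have "((\<phi> \<circ> chart_inv c' \<circ> (snd c' \<circ> chart_inv c)) has_derivative
      differential \<phi> c' p \<circ> transition c c' p) (at (snd c p))"
    using differential_has_derivative[OF at c' sm p(2)]
    by (intro diff_chain_at transition_has_derivative[OF at c c' p]) simp
  moreover have "(\<phi> \<circ> chart_inv c' \<circ> (snd c' \<circ> chart_inv c)) x = (\<phi> \<circ> chart_inv c) x"
    if "x \<in> snd c ` (fst c \<inter> fst c')" for x
    using that chart_inv_chart[OF at c] chart_inv_chart[OF at c'] by auto
  ultimately have "((\<phi> \<circ> chart_inv c) has_derivative
      differential \<phi> c' p \<circ> transition c c' p) (at (snd c p))"
    using has_derivative_transform_within_open[OF _ open_chart_overlap[OF at c c']] p by blast
  with differential_has_derivative[OF at c sm p(1)]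
  have "differential \<phi> c p = differential \<phi> c' p \<circ> transition c c' p"
    by (rule has_derivative_unique)
  then show ?thesis by simp
qed

lemma continuous_on_pullback_chart:
  assumes "smooth_atlas A" and "c \<in> A" and "W \<subseteq> fst c" and "continuous_on (snd c ` W) F"
  shows "continuous_on W (\<lambda>q. F (snd c q))"
  using continuous_on_compose2[OF assms(4) continuous_on_subset[OF continuous_on_chart[OF assms(1,2)] assms(3)]]
  by blast

lemma smooth_map_continuous:
  fixes A :: "('a::{t2_space, second_countable_topology}, 'k::finite) chart set"
  assumes at: "smooth_atlas A" and sm: "smooth_map A f"
  shows "continuous_on UNIV f"
  unfolding continuous_on_eq_continuous_within
proof
  fix p :: 'a
  let ?c = "chart_at A p"
  note ch = chart_at[OF at, of p]
  have "Ck_on 0 (snd ?c ` fst ?c) (f \<circ> chart_inv ?c)"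
    using sm ch(1) unfolding smooth_map_def smooth_on_def by blast
  then have "continuous_on (fst ?c) (\<lambda>q. (f \<circ> chart_inv ?c) (snd ?c q))"
    by (intro continuous_on_pullback_chart[OF at ch(1)]) auto
  moreover have "continuous_on (fst ?c) (\<lambda>q. (f \<circ> chart_inv ?c) (snd ?c q)) = continuous_on (fst ?c) f"
    by (rule continuous_on_cong) (auto simp: chart_inv_chart[OF at ch(1)])
  ultimately show "isCont f p"
    using continuous_on_eq_continuous_at[OF open_chart_domain[OF at ch(1)]] ch(2) by blast
qed

lemma continuous_on_differential:
  fixes A :: "('a::{t2_space, second_countable_topology}, 'k::finite) chart set"
    and \<phi> :: "'a \<Rightarrow> 'b::euclidean_space"
  assumes at: "smooth_atlas A" and c: "c \<in> A" and sm: "smooth_map A \<phi>" and W: "W \<subseteq> fst c"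
    and X: "continuous_on W X"
  shows "continuous_on W (\<lambda>q. differential \<phi> c q (X q))"
proof -
  have "differential \<phi> c q (X q) = (\<Sum>b\<in>Basis. (X q \<bullet> b) *\<^sub>R differential \<phi> c q b)" if "q \<in> W" for q
  proof -
    have "linear (differential \<phi> c q)"
      using has_derivative_linear[OF differential_has_derivative[OF at c sm]] that W by blast
    then show ?thesis
      using linear_sum[of "differential \<phi> c q" "\<lambda>b. (X q \<bullet> b) *\<^sub>R b" Basis]
      by (simp add: euclidean_representation linear_cmul)
  qed
  moreover have "continuous_on W (\<lambda>q. differential \<phi> c q b)" for b
  proof -
    have "Ck_on (Suc 0) (snd c ` fst c) (\<phi> \<circ> chart_inv c)"
      using sm c unfolding smooth_map_def smooth_on_def by blast
    then have "continuous_on (snd c ` fst c) (\<lambda>x. frechet_derivative (\<phi> \<circ> chart_inv c) (at x) b)"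
      by simp
    from continuous_on_pullback_chart[OF at c W continuous_on_subset[OF this image_mono[OF W]]]
    show ?thesis by (simp add: differential_def)
  qed
  ultimately show ?thesis
    using X by (auto intro!: continuous_intros cong: continuous_on_cong)
qed

lemma
  assumes "riemannian_metric A g" and "c \<in> A" and "p \<in> fst c"
  shows metric_bilinear: "bilinear (g c p)"
    and metric_sym: "g c p u v = g c p v u"
    and metric_pos: "v \<noteq> 0 \<Longrightarrow> g c p v v > 0"
    and metric_transition: "\<lbrakk>c' \<in> A; p \<in> fst c'\<rbrakk> \<Longrightarrow>
      g c' p (transition c c' p u) (transition c c' p v) = g c p u v"
  using assms unfolding riemannian_metric_def by auto

lemma continuous_on_metric:
  fixes A :: "('a::{t2_space, second_countable_topology}, 'k::finite) chart set"
  assumes at: "smooth_atlas A" and g: "riemannian_metric A g" and c: "c \<in> A" and W: "W \<subseteq> fst c"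
    and X: "continuous_on W X" and Y: "continuous_on W Y"
  shows "continuous_on W (\<lambda>q. g c q (X q) (Y q))"
proof -
  have "g c q (X q) (Y q) = (\<Sum>a\<in>Basis. \<Sum>b\<in>Basis. (X q \<bullet> a) * (Y q \<bullet> b) * g c q a b)"
    if "q \<in> W" for q
  proof -
    have bil: "bilinear (g c q)" using metric_bilinear[OF g c] that W by blast
    have "g c q (X q) (Y q) = g c q (\<Sum>a\<in>Basis. (X q \<bullet> a) *\<^sub>R a) (\<Sum>b\<in>Basis. (Y q \<bullet> b) *\<^sub>R b)"
      by (simp add: euclidean_representation)
    also have "\<dots> = (\<Sum>(a, b)\<in>Basis \<times> Basis. g c q ((X q \<bullet> a) *\<^sub>R a) ((Y q \<bullet> b) *\<^sub>R b))"
      by (rule bilinear_sum[OF bil])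
    finally show ?thesis
      by (simp add: bilinear_lmul[OF bil] bilinear_rmul[OF bil] sum.cartesian_product mult_ac)
  qed
  moreover have "continuous_on W (\<lambda>q. g c q a b)" for a b
  proof -
    have "Ck_on 0 (snd c ` fst c) (\<lambda>x. g c (chart_inv c x) a b)"
      using g c unfolding riemannian_metric_def smooth_on_def by blast
    then have "continuous_on (snd c ` fst c) (\<lambda>x. g c (chart_inv c x) a b)" by simp
    from continuous_on_pullback_chart[OF at c W continuous_on_subset[OF this image_mono[OF W]]]
    show ?thesis
      using W chart_inv_chart[OF at c] by (simp add: subset_iff cong: continuous_on_cong)
  qed
  ultimately show ?thesis
    using X Y by (auto intro!: continuous_intros cong: continuous_on_cong)
qed


section \<open>Orthonormal frames\<close>

text \<open>\<open>m\<close> orthonormal vectors are independent, so they span a space of dimension \<open>m\<close>; on their span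
  the expansion holds by linearity.\<close>

lemma orthonormal_expansion:
  fixes B :: "'v::euclidean_space \<Rightarrow> 'v \<Rightarrow> real"
  assumes bil: "bilinear B"
    and H: "subspace H" "dim H = m" and eH: "\<And>i. i < m \<Longrightarrow> e i \<in> H"
    and on: "\<And>i j. \<lbrakk>i < m; j < m\<rbrakk> \<Longrightarrow> B (e i) (e j) = (if i = j then 1 else 0)"
    and x: "x \<in> H"
  shows "x = (\<Sum>i<m. B x (e i) *\<^sub>R e i)"
proof -
  let ?E = "e ` {..<m}"
  note bl = bilinear_ladd[OF bil] bilinear_lmul[OF bil] bilinear_lzero[OF bil]
  have "inj_on e {..<m}"
    by (rule inj_onI) (metis on lessThan_iff zero_neq_one)
  then have card: "card ?E = m" by (simp add: card_image)
  have "independent ?E"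
    unfolding dependent_def
  proof (rule notI, elim bexE)
    fix a assume a: "a \<in> ?E" "a \<in> span (?E - {a})"
    from a(2) have "B a a = 0" if "\<And>x. x \<in> ?E - {a} \<Longrightarrow> B x a = 0"
      using span_induct[of a "?E - {a}" "\<lambda>x. B x a = 0"] that bl
      by (auto simp: subspace_def)
    moreover have "B x a = 0" if "x \<in> ?E - {a}" for x
      using that a(1) on by auto
    ultimately show False using a(1) on by force
  qed
  then have "H \<subseteq> span ?E"
    using eH H(2) card by (intro card_ge_dim_independent) auto
  then have "x \<in> span ?E" using x by blast
  then show ?thesis
  proof (induction rule: span_induct)
    case base
    show ?case
      by (auto simp: subspace_def bl scaleR_add_left sum.distrib
          simp flip: scaleR_scaleR scaleR_right.sum)
  next
    case (step x)
    then obtain j where j: "j < m" "x = e j" by blast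
    then have "(\<Sum>i<m. B x (e i) *\<^sub>R e i) = (\<Sum>i<m. if i = j then e j else 0)"
      by (intro sum.cong) (auto simp: on)
    then show ?case using j by simp
  qed
qed

text \<open>The trace of \<open>|L|\<^sup>2\<close> does not depend on the frame: expanding \<open>e\<close> in \<open>e'\<close> produces the matrix
  \<open>B (e i) (e' j)\<close>, whose columns are orthonormal because \<open>e'\<close> can be expanded in \<open>e\<close> as well.\<close>

lemma sum_norm_orthonormal_frame_eq:
  fixes B :: "'v::euclidean_space \<Rightarrow> 'v \<Rightarrow> real" and L :: "'v \<Rightarrow> 'w::real_inner"
  assumes bil: "bilinear B" and sym: "\<And>u v. B u v = B v u"
    and H: "subspace H" "dim H = m"
    and eH: "\<And>i. i < m \<Longrightarrow> e i \<in> H"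
    and e: "\<And>i j. \<lbrakk>i < m; j < m\<rbrakk> \<Longrightarrow> B (e i) (e j) = (if i = j then 1 else 0)"
    and eH': "\<And>i. i < m \<Longrightarrow> e' i \<in> H"
    and e': "\<And>i j. \<lbrakk>i < m; j < m\<rbrakk> \<Longrightarrow> B (e' i) (e' j) = (if i = j then 1 else 0)"
    and L: "linear L"
  shows "(\<Sum>i<m. L (e i) \<bullet> L (e i)) = (\<Sum>i<m. L (e' i) \<bullet> L (e' i))"
proof -
  have exp: "L (e i) = (\<Sum>j<m. B (e i) (e' j) *\<^sub>R L (e' j))" if "i < m" for i
    using arg_cong[OF orthonormal_expansion[OF bil H eH' e' eH[OF that]], of L]
    by (simp add: linear_sum[OF L] linear_cmul[OF L])
  have "(\<Sum>i<m. B (e i) (e' j) * B (e i) (e' k)) = B (e' j) (e' k)" if jk: "j < m" "k < m" for j k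
  proof -
    have "B (e' j) (e' k) = B (\<Sum>i<m. B (e' j) (e i) *\<^sub>R e i) (e' k)"
      using orthonormal_expansion[OF bil H eH e eH'[OF jk(1)]] by simp
    also have "\<dots> = (\<Sum>i<m. B (B (e' j) (e i) *\<^sub>R e i) (e' k))"
      using bil unfolding bilinear_def by (intro linear_sum[of "\<lambda>x. B x (e' k)"]) auto
    finally show ?thesis
      by (simp add: bilinear_lmul[OF bil] sym[of "e' j"])
  qed
  (* orthonormality of the columns of the change-of-frame matrix *)
  then have dual: "(\<Sum>i<m. B (e i) (e' j) * B (e i) (e' k)) = (if j = k then 1 else 0)"
    if "j < m" "k < m" for j k
    using that e' by simp
  have "(\<Sum>i<m. L (e i) \<bullet> L (e i))
      = (\<Sum>i<m. \<Sum>j<m. \<Sum>k<m. B (e i) (e' j) * B (e i) (e' k) * (L (e' j) \<bullet> L (e' k)))"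
    by (intro sum.cong refl, simp add: exp inner_sum_left inner_sum_right sum_distrib_left mult.assoc,
        subst sum.swap, simp add: mult.left_commute)
  also have "\<dots> = (\<Sum>j<m. \<Sum>k<m. \<Sum>i<m. B (e i) (e' j) * B (e i) (e' k) * (L (e' j) \<bullet> L (e' k)))"
    by (rule trans[OF sum.swap], rule sum.cong[OF refl], rule sum.swap)
  also have "\<dots> = (\<Sum>j<m. \<Sum>k<m. (\<Sum>i<m. B (e i) (e' j) * B (e i) (e' k)) * (L (e' j) \<bullet> L (e' k)))"
    by (simp add: sum_distrib_right)
  also have "\<dots> = (\<Sum>j<m. \<Sum>k<m. if j = k then L (e' j) \<bullet> L (e' k) else 0)"
    by (intro sum.cong refl) (auto simp: dual)
  finally show ?thesis by simp
qed

text \<open>A subbundle comes with local sections that span its fibres; Gram-Schmidt needs that none of them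
  depends on the previous ones. Otherwise \<open>m - 1\<close> of them would span a space of dimension \<open>m\<close>.\<close>

lemma spanning_list_independent:
  fixes E :: "nat \<Rightarrow> 'v::euclidean_space"
  assumes dim: "dim (span (E ` {..<m})) = m" and j: "j < m"
  shows "E j \<notin> span (E ` {..<j})"
proof
  assume "E j \<in> span (E ` {..<j})"
  moreover have "E ` {..<j} \<subseteq> E ` ({..<m} - {j})" using j by auto
  ultimately have "E j \<in> span (E ` ({..<m} - {j}))" using span_mono by blast
  then have "span (insert (E j) (E ` ({..<m} - {j}))) = span (E ` ({..<m} - {j}))"
    by (rule span_redundant)
  moreover have "insert (E j) (E ` ({..<m} - {j})) = E ` {..<m}" using j by auto
  ultimately have "m = dim (E ` ({..<m} - {j}))"
    using dim by (metis dim_span)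
  also have "\<dots> \<le> card (E ` ({..<m} - {j}))" by (intro dim_le_card') auto
  also have "\<dots> \<le> card ({..<m} - {j})" by (rule card_image_le) auto
  also have "\<dots> < m" using j by simp
  finally show False by simp
qed

text \<open>Gram-Schmidt orthonormalisation uses only sums, products, inverses and square roots of
  nonvanishing continuous functions, so applied at all points simultaneously it preserves
  continuity.\<close>

lemma continuous_gram_schmidt:
  fixes B :: "'a::topological_space \<Rightarrow> 'v::euclidean_space \<Rightarrow> 'v \<Rightarrow> real"
    and E :: "nat \<Rightarrow> 'a \<Rightarrow> 'v"
  assumes bil: "\<And>q. q \<in> W \<Longrightarrow> bilinear (B q)"
    and sym: "\<And>q u v. q \<in> W \<Longrightarrow> B q u v = B q v u"
    and pos: "\<And>q v. \<lbrakk>q \<in> W; v \<noteq> 0\<rbrakk> \<Longrightarrow> B q v v > 0"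
    and cont: "\<And>X Y. \<lbrakk>continuous_on W X; continuous_on W Y\<rbrakk> \<Longrightarrow> continuous_on W (\<lambda>q. B q (X q) (Y q))"
    and E: "\<And>i. i < m \<Longrightarrow> continuous_on W (E i)"
    and ind: "\<And>q j. \<lbrakk>q \<in> W; j < m\<rbrakk> \<Longrightarrow> E j q \<notin> span ((\<lambda>i. E i q) ` {..<j})"
  shows "\<exists>F. (\<forall>i<m. continuous_on W (F i)) \<and>
    (\<forall>q\<in>W. (\<forall>i<m. F i q \<in> span ((\<lambda>i. E i q) ` {..<m})) \<and>
            (\<forall>i<m. \<forall>j<m. B q (F i q) (F j q) = (if i = j then 1 else 0)))"
  using E ind
proof (induction m)
  case 0
  then show ?case by simp
next
  case (Suc m)
  have "\<exists>F. (\<forall>i<m. continuous_on W (F i)) \<and>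
    (\<forall>q\<in>W. (\<forall>i<m. F i q \<in> span ((\<lambda>i. E i q) ` {..<m})) \<and>
            (\<forall>i<m. \<forall>j<m. B q (F i q) (F j q) = (if i = j then 1 else 0)))"
    by (rule Suc.IH) (use Suc.prems in auto)
  then obtain F where Fc: "\<And>i. i < m \<Longrightarrow> continuous_on W (F i)"
    and Fs: "\<And>q i. \<lbrakk>q \<in> W; i < m\<rbrakk> \<Longrightarrow> F i q \<in> span ((\<lambda>i. E i q) ` {..<m})"
    and Fo: "\<And>q i j. \<lbrakk>q \<in> W; i < m; j < m\<rbrakk> \<Longrightarrow> B q (F i q) (F j q) = (if i = j then 1 else 0)"
    by blast
  define G where "G q = E m q - (\<Sum>i<m. B q (E m q) (F i q) *\<^sub>R F i q)" for q
  define F' where "F' = F(m := \<lambda>q. inverse (sqrt (B q (G q) (G q))) *\<^sub>R G q)"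
  have Gc: "continuous_on W G"
    unfolding G_def using Suc.prems(1) by (intro continuous_intros cont Fc) auto
  have Gpos: "B q (G q) (G q) > 0" if q: "q \<in> W" for q
  proof (rule pos[OF q])
    have "(\<Sum>i<m. B q (E m q) (F i q) *\<^sub>R F i q) \<in> span ((\<lambda>i. E i q) ` {..<m})"
      using Fs[OF q] by (intro span_sum span_scale) auto
    then show "G q \<noteq> 0" using Suc.prems(2)[OF q, of m] by (auto simp: G_def)
  qed
  have GF: "B q (G q) (F j q) = 0" if q: "q \<in> W" and j: "j < m" for q j
  proof -
    have "B q (\<Sum>i<m. B q (E m q) (F i q) *\<^sub>R F i q) (F j q)
        = (\<Sum>i<m. B q (B q (E m q) (F i q) *\<^sub>R F i q) (F j q))"
      using bil[OF q] unfolding bilinear_def by (intro linear_sum[of "\<lambda>x. B q x (F j q)"]) auto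
    also have "\<dots> = (\<Sum>i<m. if i = j then B q (E m q) (F j q) else 0)"
      by (intro sum.cong refl) (auto simp: bilinear_lmul[OF bil[OF q]] Fo[OF q _ j])
    finally show ?thesis
      using j by (simp add: G_def bilinear_lsub[OF bil[OF q]])
  qed
  have mono: "span ((\<lambda>i. E i q) ` {..<m}) \<subseteq> span ((\<lambda>i. E i q) ` {..<Suc m})" for q
    by (intro span_mono) auto
  have Gs: "G q \<in> span ((\<lambda>i. E i q) ` {..<Suc m})" if q: "q \<in> W" for q
    unfolding G_def
  proof (intro span_diff span_sum span_scale)
    show "F i q \<in> span ((\<lambda>i. E i q) ` {..<Suc m})" if "i \<in> {..<m}" for i
      using that Fs[OF q] mono by auto
  qed (auto intro: span_base)
  have "continuous_on W (F' i)" if "i < Suc m" for i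
    using that Fc Gpos
    by (auto simp: F'_def less_Suc_eq intro!: continuous_intros cont Gc) (force dest: Gpos)+
  moreover have "F' i q \<in> span ((\<lambda>i. E i q) ` {..<Suc m})" if "q \<in> W" "i < Suc m" for q i
    using that Fs mono Gs by (auto simp: F'_def less_Suc_eq intro!: span_scale)
  moreover have "B q (F' i q) (F' j q) = (if i = j then 1 else 0)"
    if q: "q \<in> W" and ij: "i < Suc m" "j < Suc m" for q i j
  proof -
    have "inverse (sqrt (B q (G q) (G q))) * (inverse (sqrt (B q (G q) (G q))) * B q (G q) (G q)) = 1"
      using Gpos[OF q] by (simp add: field_simps)
    moreover have "B q (F j q) (G q) = 0" if "j < m" for j
      using GF[OF q that] sym[OF q, of "F j q" "G q"] by simp
    ultimately show ?thesis
      using ij GF[OF q] Fo[OF q]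
      by (auto simp: F'_def less_Suc_eq bilinear_lmul[OF bil[OF q]] bilinear_rmul[OF bil[OF q]])
  qed
  ultimately show ?case by blast
qed

lemma
  assumes "smooth_subbundle A m H" and "c \<in> A" and "p \<in> fst c"
  shows subbundle_subspace: "subspace (H c p)" and subbundle_dim: "dim (H c p) = m"
    and subbundle_transition: "\<lbrakk>c' \<in> A; p \<in> fst c'\<rbrakk> \<Longrightarrow> H c' p = transition c c' p ` H c p"
  using bspec[OF bspec[OF assms(1)[unfolded smooth_subbundle_def] assms(2)] assms(3)]
  by (elim conjE; simp)+

lemma local_orthonormal_frame:
  fixes A :: "('a::{t2_space, second_countable_topology}, 'k::finite) chart set"
  assumes at: "smooth_atlas A" and g: "riemannian_metric A g" and H: "smooth_subbundle A m H"
    and c: "c \<in> A" and p: "p \<in> fst c"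
  shows "\<exists>W F. open W \<and> p \<in> W \<and> W \<subseteq> fst c \<and> (\<forall>i<m. continuous_on W (F i)) \<and>
    (\<forall>q\<in>W. (\<forall>i<m. F i q \<in> H c q) \<and>
            (\<forall>i<m. \<forall>j<m. g c q (F i q) (F j q) = (if i = j then 1 else 0)))"
proof -
  have "\<exists>W E. open W \<and> p \<in> W \<and> W \<subseteq> fst c \<and> (\<forall>i<m. smooth_on (snd c ` W) (E i)) \<and>
      (\<forall>q\<in>W. span ((\<lambda>i. E i (snd c q)) ` {..<m}) = H c q)"
    using bspec[OF bspec[OF H[unfolded smooth_subbundle_def] c] p] by (elim conjE)
  then obtain W E where WE: "open W \<and> p \<in> W \<and> W \<subseteq> fst c \<and>
      (\<forall>i<m. smooth_on (snd c ` W) (E i)) \<and>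
      (\<forall>q\<in>W. span ((\<lambda>i. E i (snd c q)) ` {..<m}) = H c q)"
    by (elim exE)
  then have W: "open W" "p \<in> W" "W \<subseteq> fst c"
    and Es: "\<forall>i<m. smooth_on (snd c ` W) (E i)"
    and Esp: "\<forall>q\<in>W. span ((\<lambda>i. E i (snd c q)) ` {..<m}) = H c q"
    by simp_all
  have Ec: "continuous_on W (\<lambda>q. E i (snd c q))" if "i < m" for i
  proof -
    have "Ck_on 0 (snd c ` W) (E i)" using Es that unfolding smooth_on_def by blast
    then show ?thesis by (intro continuous_on_pullback_chart[OF at c W(3)]) simp
  qed
  have ind: "E j (snd c q) \<notin> span ((\<lambda>i. E i (snd c q)) ` {..<j})" if "q \<in> W" "j < m" for q j
    using spanning_list_independent[of "\<lambda>i. E i (snd c q)" m j] that Esp subbundle_dim[OF H c] W(3)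
    by auto
  have "\<exists>F. (\<forall>i<m. continuous_on W (F i)) \<and>
    (\<forall>q\<in>W. (\<forall>i<m. F i q \<in> span ((\<lambda>i. E i (snd c q)) ` {..<m})) \<and>
            (\<forall>i<m. \<forall>j<m. g c q (F i q) (F j q) = (if i = j then 1 else 0)))"
  proof (rule continuous_gram_schmidt[where B = "g c" and E = "\<lambda>i q. E i (snd c q)", rotated 4])
    show "continuous_on W (\<lambda>q. E i (snd c q))" if "i < m" for i by (rule Ec[OF that])
    show "E j (snd c q) \<notin> span ((\<lambda>i. E i (snd c q)) ` {..<j})" if "q \<in> W" "j < m" for q j
      by (rule ind[OF that])
    fix q assume "q \<in> W"
    then have q: "q \<in> fst c" using W(3) by blast
    show "bilinear (g c q)" by (rule metric_bilinear[OF g c q])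
    show "g c q u v = g c q v u" for u v by (rule metric_sym[OF g c q])
    show "g c q v v > 0" if "v \<noteq> 0" for v by (rule metric_pos[OF g c q that])
  next
    show "continuous_on W (\<lambda>q. g c q (X q) (Y q))"
      if "continuous_on W X" "continuous_on W Y" for X Y
      by (rule continuous_on_metric[OF at g c W(3) that])
  qed
  then obtain F where F: "(\<forall>i<m. continuous_on W (F i)) \<and>
    (\<forall>q\<in>W. (\<forall>i<m. F i q \<in> span ((\<lambda>i. E i (snd c q)) ` {..<m})) \<and>
            (\<forall>i<m. \<forall>j<m. g c q (F i q) (F j q) = (if i = j then 1 else 0)))"
    by (elim exE)
  show ?thesis
    using W F Esp by (intro exI[of _ W] exI[of _ F] conjI ballI allI impI) simp_all
qed

lemma frame_at:
  fixes A :: "('a::{t2_space, second_countable_topology}, 'k::finite) chart set"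
  assumes at: "smooth_atlas A" and g: "riemannian_metric A g" and H: "smooth_subbundle A m H"
  shows "i < m \<Longrightarrow> frame_at A m H g p i \<in> H (chart_at A p) p"
    and "\<lbrakk>i < m; j < m\<rbrakk> \<Longrightarrow> g (chart_at A p) p (frame_at A m H g p i) (frame_at A m H g p j)
      = (if i = j then 1 else 0)"
proof -
  obtain W F where "open W \<and> p \<in> W \<and> W \<subseteq> fst (chart_at A p) \<and> (\<forall>i<m. continuous_on W (F i)) \<and>
    (\<forall>q\<in>W. (\<forall>i<m. F i q \<in> H (chart_at A p) q) \<and>
      (\<forall>i<m. \<forall>j<m. g (chart_at A p) q (F i q) (F j q) = (if i = j then 1 else 0)))"
    using local_orthonormal_frame[OF at g H chart_at[OF at, of p]] by (elim exE)
  then have "\<exists>e. (\<forall>i<m. e i \<in> H (chart_at A p) p) \<and>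
        (\<forall>i<m. \<forall>j<m. g (chart_at A p) p (e i) (e j) = (if i = j then 1 else 0))"
    by (intro exI[of _ "\<lambda>i. F i p"] conjI) simp_all
  then have e: "(\<forall>i<m. frame_at A m H g p i \<in> H (chart_at A p) p) \<and>
        (\<forall>i<m. \<forall>j<m. g (chart_at A p) p (frame_at A m H g p i) (frame_at A m H g p j)
          = (if i = j then 1 else 0))"
    unfolding frame_at_def by (rule someI_ex)
  show "i < m \<Longrightarrow> frame_at A m H g p i \<in> H (chart_at A p) p" using e by simp
  show "\<lbrakk>i < m; j < m\<rbrakk> \<Longrightarrow> g (chart_at A p) p (frame_at A m H g p i) (frame_at A m H g p j)
      = (if i = j then 1 else 0)" using e by simp
qed

text \<open>The chart and the frame chosen at \<open>p\<close> can be replaced by any others: transport the chosen frame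
  to the chart \<open>c\<close>, where it stays orthonormal, and compare two frames of the same fibre.\<close>

lemma norm_dH_sq_eq:
  fixes A :: "('a::{t2_space, second_countable_topology}, 'k::finite) chart set"
    and \<phi> :: "'a \<Rightarrow> 'b::euclidean_space"
  assumes at: "smooth_atlas A" and g: "riemannian_metric A g" and H: "smooth_subbundle A m H"
    and sm: "smooth_map A \<phi>" and c: "c \<in> A" and p: "p \<in> fst c"
    and FH: "\<And>i. i < m \<Longrightarrow> F i \<in> H c p"
    and F: "\<And>i j. \<lbrakk>i < m; j < m\<rbrakk> \<Longrightarrow> g c p (F i) (F j) = (if i = j then 1 else 0)"
  shows "norm_dH_sq A m H g \<phi> p = (\<Sum>i<m. differential \<phi> c p (F i) \<bullet> differential \<phi> c p (F i))"
proof -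
  let ?c = "chart_at A p" and ?e = "frame_at A m H g p"
  let ?T = "transition ?c c p"
  note ch = chart_at[OF at, of p] and fr = frame_at[OF at g H]
  have "norm_dH_sq A m H g \<phi> p = (\<Sum>i<m. differential \<phi> c p (?T (?e i)) \<bullet> differential \<phi> c p (?T (?e i)))"
    by (simp add: norm_dH_sq_def Let_def differential_transition[OF at ch(1) c sm ch(2) p])
  also have "\<dots> = (\<Sum>i<m. differential \<phi> c p (F i) \<bullet> differential \<phi> c p (F i))"
  proof (rule sum_norm_orthonormal_frame_eq[OF metric_bilinear[OF g c p] metric_sym[OF g c p]
        subbundle_subspace[OF H c p] subbundle_dim[OF H c p]])
    show "?T (?e i) \<in> H c p" if "i < m" for i
      using fr(1)[OF that] subbundle_transition[OF H ch c p] by simp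
    show "g c p (?T (?e i)) (?T (?e j)) = (if i = j then 1 else 0)" if "i < m" "j < m" for i j
      using fr(2)[OF that] metric_transition[OF g ch c p] by simp
    show "linear (differential \<phi> c p)"
      by (rule has_derivative_linear[OF differential_has_derivative[OF at c sm p]])
  qed (use FH F in auto)
  finally show ?thesis .
qed

text \<open>The frames chosen at the points need not fit together continuously. Near each point a
  continuous frame may be used instead.\<close>

lemma continuous_norm_dH_sq:
  fixes A :: "('a::{t2_space, second_countable_topology}, 'k::finite) chart set"
    and \<phi> :: "'a \<Rightarrow> 'b::euclidean_space"
  assumes at: "smooth_atlas A" and g: "riemannian_metric A g" and H: "smooth_subbundle A m H"
    and sm: "smooth_map A \<phi>"
  shows "continuous_on UNIV (norm_dH_sq A m H g \<phi>)"
proof -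
  have "isCont (norm_dH_sq A m H g \<phi>) p" for p
  proof -
    obtain c where c: "c \<in> A" "p \<in> fst c" using chart_cover[OF at, of p] by blast
    obtain W F where WF: "open W \<and> p \<in> W \<and> W \<subseteq> fst c \<and> (\<forall>i<m. continuous_on W (F i)) \<and>
      (\<forall>q\<in>W. (\<forall>i<m. F i q \<in> H c q) \<and>
        (\<forall>i<m. \<forall>j<m. g c q (F i q) (F j q) = (if i = j then 1 else 0)))"
      using local_orthonormal_frame[OF at g H c] by (elim exE)
    then have W: "open W" "p \<in> W" "W \<subseteq> fst c"
      and Fc: "\<And>i. i < m \<Longrightarrow> continuous_on W (F i)"
      and FH: "\<And>q i. \<lbrakk>q \<in> W; i < m\<rbrakk> \<Longrightarrow> F i q \<in> H c q"
      and F: "\<And>q i j. \<lbrakk>q \<in> W; i < m; j < m\<rbrakk> \<Longrightarrow> g c q (F i q) (F j q) = (if i = j then 1 else 0)"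
      by simp_all
    have "norm_dH_sq A m H g \<phi> q = (\<Sum>i<m. differential \<phi> c q (F i q) \<bullet> differential \<phi> c q (F i q))"
      if "q \<in> W" for q
    proof (rule norm_dH_sq_eq[OF at g H sm c(1), where F = "\<lambda>i. F i q"])
      show "q \<in> fst c" using that W(3) by blast
    qed (use FH[OF that] F[OF that] in auto)
    moreover have "continuous_on W
        (\<lambda>q. \<Sum>i<m. differential \<phi> c q (F i q) \<bullet> differential \<phi> c q (F i q))"
      by (intro continuous_on_sum continuous_on_inner continuous_on_differential[OF at c(1) sm W(3)] Fc)
         auto
    ultimately have "continuous_on W (norm_dH_sq A m H g \<phi>)"
      using continuous_on_cong[OF refl, of W "norm_dH_sq A m H g \<phi>"] by simp
    then show ?thesis using W continuous_on_eq_continuous_at by blast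
  qed
  then show ?thesis by (simp add: continuous_at_imp_continuous_on)
qed


section \<open>The Riemannian volume of a compact manifold\<close>

text \<open>The density \<open>sqrt (det g)\<close> is bounded on compact coordinate balls, so every point has a
  neighbourhood of finite volume; finitely many of these cover the manifold.\<close>

lemma finite_measure_riemannian_volume:
  fixes A :: "('a::{t2_space, second_countable_topology}, 'k::finite) chart set"
  assumes at: "smooth_atlas A" and g: "riemannian_metric A g" and vol: "riemannian_volume A g vol"
    and cpt: "compact (UNIV :: 'a set)"
  shows "finite_measure vol"
proof -
  have sets: "sets vol = sets borel" using vol by (simp add: riemannian_volume_def)
  then have space: "space vol = UNIV" by (metis sets_eq_imp_space_eq space_borel)
  have "\<exists>U. open U \<and> p \<in> U \<and> emeasure vol U < \<infinity>" for p
  proof -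
    obtain c where c: "c \<in> A" "p \<in> fst c" using chart_cover[OF at, of p] by blast
    let ?S = "snd c ` fst c"
    let ?d = "\<lambda>x. sqrt (det (\<chi> i j. g c (chart_inv c x) (axis i 1) (axis j 1)))"
    obtain r where r: "r > 0" "cball (snd c p) r \<subseteq> ?S"
      using open_chart_image[OF at c(1)] c(2) unfolding open_contains_cball by blast
    define U where "U = snd c -` ball (snd c p) r \<inter> fst c"
    have U: "open U" "p \<in> U" "U \<subseteq> fst c"
      using continuous_on_open_vimage[OF open_chart_domain[OF at c(1)], of "snd c"]
        continuous_on_chart[OF at c(1)] r c by (auto simp: U_def)
    have "smooth_on ?S (\<lambda>x. g c (chart_inv c x) u v)" for u v
      using g c(1) unfolding riemannian_metric_def by blast
    then have "Ck_on 0 ?S (\<lambda>x. g c (chart_inv c x) u v)" for u v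
      unfolding smooth_on_def by blast
    then have "continuous_on ?S (\<lambda>x. g c (chart_inv c x) u v)" for u v
      by simp
    then have "continuous_on ?S ?d"
      by (simp add: det_def)
         (intro continuous_on_real_sqrt continuous_on_sum continuous_on_mult continuous_on_const
           continuous_on_prod, simp)
    then have "bounded (?d ` cball (snd c p) r)"
      using r(2) by (intro compact_imp_bounded compact_continuous_image) (auto intro: continuous_on_subset)
    then obtain K where "\<forall>y \<in> ?d ` cball (snd c p) r. norm y \<le> K"
      unfolding bounded_iff by blast
    then have K: "?d x \<le> K" if "x \<in> cball (snd c p) r" for x
      using that by (simp add: abs_le_iff)
    have "emeasure vol U = (\<integral>\<^sup>+x. ennreal (?d x) * indicator (snd c ` U) x \<partial>lborel)"
      using vol c(1) U unfolding riemannian_volume_def by simp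
    also have "\<dots> \<le> (\<integral>\<^sup>+x. ennreal K * indicator (cball (snd c p) r) x \<partial>lborel)"
    proof (rule nn_integral_mono)
      fix x
      show "ennreal (?d x) * indicator (snd c ` U) x \<le> ennreal K * indicator (cball (snd c p) r) x"
        using K[of x] by (auto simp: U_def indicator_def ennreal_leI)
    qed
    also have "\<dots> = ennreal K * emeasure lborel (cball (snd c p) r)"
      by (rule nn_integral_cmult_indicator) simp
    also have "\<dots> < \<infinity>"
      using emeasure_lborel_cball_finite[of "snd c p" r] by (simp add: ennreal_mult_less_top)
    finally show ?thesis using U by blast
  qed
  then obtain U where U: "\<And>p. open (U p)" "\<And>p. p \<in> U p" "\<And>p. emeasure vol (U p) < \<infinity>"
    by metis
  obtain T where T: "finite T" "UNIV = (\<Union>p\<in>T. U p)"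
    using compactE_image[OF cpt, of UNIV U] U(1,2) by (metis UNIV_I UN_I subsetI top.extremum_uniqueI)
  have "emeasure vol UNIV \<le> (\<Sum>p\<in>T. emeasure vol (U p))"
    unfolding T(2) using T(1) U(1) sets by (intro emeasure_subadditive_finite) auto
  also have "\<dots> < \<infinity>"
    using T(1) U(3) by simp
  finally show ?thesis by (intro finite_measureI) (simp add: space)
qed


section \<open>The index form on projected constant fields\<close>

lemma smooth_map_inner_left:
  fixes A :: "('a::{t2_space, second_countable_topology}, 'k::finite) chart set"
    and f :: "'a \<Rightarrow> 'b::euclidean_space"
  assumes at: "smooth_atlas A" and sm: "smooth_map A f"
  shows "smooth_map A (\<lambda>p. a \<bullet> f p)"
  unfolding smooth_map_def smooth_on_def
proof (intro ballI allI)
  fix c k assume c: "c \<in> A"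
  have "Ck_on k (snd c ` fst c) (f \<circ> chart_inv c)"
    using sm c by (simp add: smooth_map_def smooth_on_def)
  from Ck_on_bilinear[OF open_chart_image[OF at c] bounded_bilinear_inner
      Ck_on_const[OF open_chart_image[OF at c]] this]
  show "Ck_on k (snd c ` fst c) ((\<lambda>p. a \<bullet> f p) \<circ> chart_inv c)" by (simp add: o_def)
qed

lemma differential_inner_left:
  fixes A :: "('a::{t2_space, second_countable_topology}, 'k::finite) chart set"
    and f :: "'a \<Rightarrow> 'b::euclidean_space"
  assumes at: "smooth_atlas A" and sm: "smooth_map A f" and c: "c \<in> A" and p: "p \<in> fst c"
  shows "differential (\<lambda>p. a \<bullet> f p) c p v = a \<bullet> differential f c p v"
proof -
  have "((\<lambda>p. a \<bullet> f p) \<circ> chart_inv c has_derivative (\<lambda>v. a \<bullet> differential f c p v)) (at (snd c p))"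
    using has_derivative_inner_right[OF differential_has_derivative[OF at c sm p]] by (simp add: o_def)
  with differential_has_derivative[OF at c smooth_map_inner_left[OF at sm] p]
  have "differential (\<lambda>p. a \<bullet> f p) c p = (\<lambda>v. a \<bullet> differential f c p v)"
    by (rule has_derivative_unique)
  then show ?thesis by simp
qed

lemma differential_sphere_orthogonal:
  fixes A :: "('a::{t2_space, second_countable_topology}, 'k::finite) chart set"
    and f :: "'a \<Rightarrow> 'b::euclidean_space"
  assumes at: "smooth_atlas A" and sm: "smooth_map A f" and im: "range f \<subseteq> sphere 0 1"
    and c: "c \<in> A" and p: "p \<in> fst c"
  shows "differential f c p v \<bullet> f p = 0"
proof -
  let ?F = "f \<circ> chart_inv c"
  have one: "f q \<bullet> f q = 1" for q
    using im by (auto simp: image_subset_iff norm_eq_1)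
  have "((\<lambda>x. ?F x \<bullet> ?F x) has_derivative
      (\<lambda>v. ?F (snd c p) \<bullet> differential f c p v + differential f c p v \<bullet> ?F (snd c p))) (at (snd c p))"
    using differential_has_derivative[OF at c sm p] by (intro has_derivative_inner)
  moreover have "((\<lambda>x. ?F x \<bullet> ?F x) has_derivative (\<lambda>v. 0)) (at (snd c p))"
    by (simp add: one)
  ultimately have "(\<lambda>v. ?F (snd c p) \<bullet> differential f c p v + differential f c p v \<bullet> ?F (snd c p)) = (\<lambda>v. 0)"
    by (rule has_derivative_unique)
  from fun_cong[OF this, of v] show ?thesis
    by (simp add: chart_inv_chart[OF at c p] inner_commute)
qed

lemma proj_field_section_along:
  fixes A :: "('a::{t2_space, second_countable_topology}, 'k::finite) chart set"
    and f :: "'a \<Rightarrow> 'b::euclidean_space"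
  assumes at: "smooth_atlas A" and sm: "smooth_map A f" and im: "range f \<subseteq> sphere 0 1"
  shows "proj_field a \<circ> f \<in> sections_along A (sphere 0 1) f"
proof -
  have "smooth_map A (proj_field a \<circ> f)"
    unfolding smooth_map_def
  proof
    fix c assume c: "c \<in> A"
    have "smooth_on (snd c ` fst c) (f \<circ> chart_inv c)" using sm c by (simp add: smooth_map_def)
    from smooth_on_proj_field_comp[OF open_chart_image[OF at c] this, of a]
    show "smooth_on (snd c ` fst c) (proj_field a \<circ> f \<circ> chart_inv c)" by (simp add: o_def)
  qed
  moreover have "(proj_field a \<circ> f) p \<in> tangent_space (sphere 0 1) (f p)" for p
    unfolding o_def by (rule proj_field_tangent) (use im in blast)
  ultimately show ?thesis by (simp add: sections_along_def)
qed

text \<open>Here \<open>V\<^sub>a = X\<^sub>a \<circ> f\<close> satisfies \<open>\<nabla>V\<^sub>a = - (a \<bullet> f) df\<close>, \<open>|V\<^sub>a|\<^sup>2 = |a|\<^sup>2 - (a \<bullet> f)\<^sup>2\<close> and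
  \<open>V\<^sub>a \<bullet> df = a \<bullet> df\<close>. The curvature term then contains \<open>\<Sum>\<^sub>i (a \<bullet> df(e\<^sub>i))\<^sup>2\<close>, which is written as
  the horizontal energy density of the real function \<open>a \<bullet> f\<close>, so that its continuity is an
  instance of \<open>continuous_norm_dH_sq\<close>.\<close>

lemma index_form_proj_field:
  fixes A :: "('a::{t2_space, second_countable_topology}, 'k::finite) chart set"
    and f :: "'a \<Rightarrow> 'b::euclidean_space"
  assumes at: "smooth_atlas A"
    and LC: "levi_civita_connection (sphere 0 1) D"
    and curv: "curvature_tensor (sphere 0 1) D R"
    and pb: "pullback_connection A (sphere 0 1) D f P"
    and sm: "smooth_map A f" and im: "range f \<subseteq> sphere 0 1"
  shows "index_form A m H g vol P R f (proj_field a \<circ> f) =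
    (\<integral>p. exp (norm_dH_sq A m H g f p / 2) *
       ((a \<bullet> f p)\<^sup>2 * (norm_dH_sq A m H g f p)\<^sup>2 + (a \<bullet> f p)\<^sup>2 * norm_dH_sq A m H g f p
        - ((a \<bullet> a - (a \<bullet> f p)\<^sup>2) * norm_dH_sq A m H g f p
           - norm_dH_sq A m H g (\<lambda>p. a \<bullet> f p) p)) \<partial>vol)"
  unfolding index_form_def Let_def
proof (rule Bochner_Integration.integral_cong[OF refl])
  fix p
  let ?c = "chart_at A p" and ?e = "frame_at A m H g p"
  define w where "w i = differential f ?c p (?e i)" for i
  define s where "s = norm_dH_sq A m H g f p"
  define h where "h = a \<bullet> f p"
  define V where "V = proj_field a (f p)"
  note ch = chart_at[OF at, of p]
  have fp: "f p \<in> sphere 0 1" "f p \<bullet> f p = 1" using im by (auto simp: image_subset_iff norm_eq_1)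
  have wf: "w i \<bullet> f p = 0" for i
    unfolding w_def by (rule differential_sphere_orthogonal[OF at sm im ch])
  have Vf: "V \<bullet> f p = 0"
    by (simp add: V_def proj_field_def inner_diff_left fp)
  have Vw: "V \<bullet> w i = a \<bullet> w i" "w i \<bullet> V = a \<bullet> w i" for i
    using proj_field_inner_tangent[OF wf, of a i] by (simp_all add: V_def inner_commute)
  have VV: "V \<bullet> V = a \<bullet> a - h\<^sup>2"
    by (simp add: V_def proj_field_def h_def inner_diff_left inner_diff_right fp inner_commute power2_eq_square)
  have s: "(\<Sum>i<m. w i \<bullet> w i) = s"
    by (simp add: s_def norm_dH_sq_def Let_def w_def)
  have t: "(\<Sum>i<m. (a \<bullet> w i)\<^sup>2) = norm_dH_sq A m H g (\<lambda>p. a \<bullet> f p) p"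
    by (simp add: norm_dH_sq_def Let_def w_def differential_inner_left[OF at sm ch] power2_eq_square)
  have "P ?c p (?e i) (proj_field a \<circ> f) = D (f p) (w i) (proj_field a)" for i
    using pb proj_field_vector_field ch unfolding pullback_connection_def w_def by blast
  then have DV: "P ?c p (?e i) (proj_field a \<circ> f) = - h *\<^sub>R w i" for i
    by (simp add: levi_civita_sphere_proj_field[OF LC fp(1) wf] h_def)
  have R: "R (f p) (w i) V V \<bullet> w i = (a \<bullet> a - h\<^sup>2) * (w i \<bullet> w i) - (a \<bullet> w i)\<^sup>2" for i
    by (simp add: curvature_sphere[OF LC curv fp(1) wf Vf] inner_diff_left VV Vw
        power2_eq_square)
  have "(\<Sum>i<m. P ?c p (?e i) (proj_field a \<circ> f) \<bullet> w i) = - h * s"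
    by (simp add: DV s[symmetric] sum_distrib_left sum_negf)
  moreover have "(\<Sum>i<m. P ?c p (?e i) (proj_field a \<circ> f) \<bullet> P ?c p (?e i) (proj_field a \<circ> f)) = h\<^sup>2 * s"
    by (simp add: DV power2_eq_square mult.assoc flip: s sum_distrib_left)
  moreover have "(\<Sum>i<m. R (f p) (w i) V V \<bullet> w i)
      = (a \<bullet> a - h\<^sup>2) * s - norm_dH_sq A m H g (\<lambda>p. a \<bullet> f p) p"
    by (simp add: R sum_subtractf t flip: s sum_distrib_left)
  ultimately show "exp (norm_dH_sq A m H g f p / 2) *
      ((\<Sum>i<m. P ?c p (?e i) (proj_field a \<circ> f) \<bullet> differential f ?c p (?e i))\<^sup>2
       + (\<Sum>i<m. P ?c p (?e i) (proj_field a \<circ> f) \<bullet> P ?c p (?e i) (proj_field a \<circ> f))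
       - (\<Sum>i<m. R (f p) (differential f ?c p (?e i)) ((proj_field a \<circ> f) p) ((proj_field a \<circ> f) p)
             \<bullet> differential f ?c p (?e i)))
    = exp (norm_dH_sq A m H g f p / 2) *
       ((a \<bullet> f p)\<^sup>2 * (norm_dH_sq A m H g f p)\<^sup>2 + (a \<bullet> f p)\<^sup>2 * norm_dH_sq A m H g f p
        - ((a \<bullet> a - (a \<bullet> f p)\<^sup>2) * norm_dH_sq A m H g f p
           - norm_dH_sq A m H g (\<lambda>p. a \<bullet> f p) p))"
    unfolding w_def[symmetric] s_def[symmetric] h_def[symmetric] o_apply V_def[symmetric]
    by (simp add: o_def power_mult_distrib)
qed

lemma integrable_continuous_compact_space:
  fixes u :: "'a::{t2_space, second_countable_topology} \<Rightarrow> real"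
  assumes "compact (UNIV :: 'a set)" and "finite_measure M" and "sets M = sets borel"
    and u: "continuous_on UNIV u"
  shows "integrable M u"
proof -
  interpret finite_measure M by fact
  have "bounded (range u)"
    using compact_continuous_image[OF u assms(1)] by (rule compact_imp_bounded)
  then obtain K where K: "\<And>p. \<bar>u p\<bar> \<le> K" by (auto simp: bounded_iff)
  have "u \<in> borel_measurable M"
    using borel_measurable_continuous_onI[OF u] assms(3) measurable_cong_sets by blast
  then show ?thesis
    by (rule integrable_const_bound[rotated, of _ K]) (simp add: K)
qed

theorem theorem3p3:
  fixes A :: "('a::{t2_space, second_countable_topology}, 'k::finite) chart set"
    and H :: "('a, 'k) chart \<Rightarrow> 'a \<Rightarrow> (real^'k) set"
    and g :: "('a, 'k) chart \<Rightarrow> 'a \<Rightarrow> real^'k \<Rightarrow> real^'k \<Rightarrow> real"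
    and vol :: "'a measure"
    and f :: "'a \<Rightarrow> real^'l::finite"
    and m d n :: nat
  assumes "CARD('k) = m + d" and "CARD('l) = n + 1"
    and "compact (UNIV :: 'a set)" and "connected (UNIV :: 'a set)"
    and "smooth_atlas A"
    and "riemannian_metric A g"
    and "smooth_subbundle A m H"
    and "riemannian_volume A g vol"
    and "levi_civita_connection (sphere 0 1) D"
    and "curvature_tensor (sphere 0 1) D R"
    and "pullback_connection A (sphere 0 1) D f P"
    and "exp_subelliptic_harmonic A m H g vol (sphere 0 1) f"
    and "\<not> f constant_on UNIV"
    and "(\<integral>p. exp (norm_dH_sq A m H g f p / 2) * norm_dH_sq A m H g f p
               * (norm_dH_sq A m H g f p - (real n - 2)) \<partial>vol) < 0"
  shows "unstable A m H g vol (sphere 0 1) P R f"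
proof
  assume stable: "stable A m H g vol (sphere 0 1) P R f"
  note at = \<open>smooth_atlas A\<close>
  have sm: "smooth_map A f" and im: "range f \<subseteq> sphere 0 1"
    using assms(12) by (simp_all add: exp_subelliptic_harmonic_def)
  define s where "s = norm_dH_sq A m H g f"
  define t where "t a = norm_dH_sq A m H g (\<lambda>p. a \<bullet> f p)" for a
  define J where "J a p = exp (s p / 2) * ((a \<bullet> f p)\<^sup>2 * (s p)\<^sup>2 + (a \<bullet> f p)\<^sup>2 * s p
      - ((a \<bullet> a - (a \<bullet> f p)\<^sup>2) * s p - t a p))" for a p
  have index: "index_form A m H g vol P R f (proj_field a \<circ> f) = (\<integral>p. J a p \<partial>vol)" for a
    using index_form_proj_field[OF at assms(9,10,11) sm im] by (simp add: J_def s_def t_def)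
  have nonneg: "(\<integral>p. J a p \<partial>vol) \<ge> 0" for a
  proof -
    have "compact (closure {p. (proj_field a \<circ> f) p \<noteq> 0})"
      using compact_Int_closed[OF assms(3) closed_closure] by simp
    then show ?thesis
      using stable proj_field_section_along[OF at sm im, of a]
      unfolding stable_def compactly_supported_def by (simp flip: index)
  qed
  have "continuous_on UNIV f" by (rule smooth_map_continuous[OF at sm])
  then have "continuous_on UNIV (J a)" for a
    unfolding J_def s_def t_def
    by (intro continuous_intros continuous_norm_dH_sq[OF at assms(6,7)] sm
        smooth_map_inner_left[OF at sm]) auto
  then have int: "integrable vol (J a)" for a
    using assms(8) finite_measure_riemannian_volume[OF at assms(6,8,3)]
    by (intro integrable_continuous_compact_space[OF assms(3)]) (auto simp: riemannian_volume_def)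
  have sum: "(\<Sum>a\<in>Basis. J a p) = exp (s p / 2) * s p * (s p - (real n - 2))" for p
  proof -
    let ?c = "chart_at A p"
    note ch = chart_at[OF at, of p]
    have "f p \<bullet> f p = 1" using im by (auto simp: image_subset_iff norm_eq_1)
    then have h: "(\<Sum>a\<in>Basis. (a \<bullet> f p)\<^sup>2) = 1"
      by (simp add: euclidean_inner[of "f p" "f p"] power2_eq_square inner_commute)
    have card: "(\<Sum>a\<in>Basis. (a::real^'l) \<bullet> a) = real n + 1"
      using assms(2) by (simp add: inner_same_Basis)
    (* Parseval's identity for each vector df(e_i) *)
    have t: "(\<Sum>a\<in>Basis. t a p) = s p"
      unfolding t_def s_def norm_dH_sq_def Let_def differential_inner_left[OF at sm ch]
      by (subst sum.swap) (simp add: euclidean_inner[of "differential f _ _ _"] inner_commute)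
    have "(\<Sum>a\<in>Basis. J a p) = exp (s p / 2) * ((\<Sum>a\<in>Basis. (a \<bullet> f p)\<^sup>2) * (s p)\<^sup>2
        + (\<Sum>a\<in>Basis. (a \<bullet> f p)\<^sup>2) * s p
        - (((\<Sum>a\<in>Basis. (a::real^'l) \<bullet> a) - (\<Sum>a\<in>Basis. (a \<bullet> f p)\<^sup>2)) * s p - (\<Sum>a\<in>Basis. t a p)))"
      unfolding J_def
      by (simp only: sum_distrib_left[symmetric] sum_distrib_right[symmetric] sum.distrib
          sum_subtractf left_diff_distrib)
    then show ?thesis
      unfolding h card t by (simp add: power2_eq_square algebra_simps)
  qed
  have "0 \<le> (\<Sum>a\<in>Basis. \<integral>p. J a p \<partial>vol)"
    by (intro sum_nonneg nonneg)
  also have "\<dots> = (\<integral>p. (\<Sum>a\<in>Basis. J a p) \<partial>vol)"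
    using int by simp
  also have "\<dots> < 0"
    unfolding sum using assms(14) by (simp add: s_def)
  finally show False by simp
qed

end
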